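(* Let $\hat U\in\mathrm{St}(n,p)$, let $R^{\mathsf{PL}}_{\hat U}$ be the polar-light retraction, $R^{\mathsf{PF}}_{\hat U}$ the full polar factor retraction, and $\mathrm{Exp}_{\hat U}$, $\mathrm{Log}_{\hat U}$ the Riemannian exponential and logarithm on $\mathrm{St}(n,p)$ at $\hat U$. (i) When both maps are restricted to $T^{\parallel}_{\hat U}\mathrm{St}(n,p)$, the polar-light retraction coincides with the Riemannian exponential: $$R^{\mathsf{PL}}_{\hat U}\big\vert_{T^{\parallel}_{\hat U}\mathrm{St}(n,p)}=\mathrm{Exp}_{\hat U}\big\vert_{T^{\parallel}_{\hat U}\mathrm{St}(n,p)},\qquad (R^{\mathsf{PL}}_{\hat U})^{-1}\big\vert_{R^{\mathsf{PL}}_{\hat U}\left(T^{\parallel}_{\hat U}\mathrm{St}(n,p)\right)}=\mathrm{Log}_{\hat U}\big\vert_{\mathrm{Exp}_{\hat U}\left(T^{\parallel}_{\hat U}\mathrm{St}(n,p)\right)}.$$ (ii) When restricted to $T^{\perp}_{\hat U}\mathrm{St}(n,p)$, the polar-light retraction coincides with the full polar factor retraction: $$R^{\mathsf{PL}}_{\hat U}\big\vert_{T^{\perp}_{\hat U}\mathrm{St}(n,p)}=R^{\mathsf{PF}}_{\hat U}\big\vert_{T^{\perp}_{\hat U}\mathrm{St}(n,p)},\qquad (R^{\mathsf{PL}}_{\hat U})^{-1}\big\vert_{R^{\mathsf{PL}}_{\hat U}\left(T^{\perp}_{\hat U}\mathrm{St}(n,p)\right)}=(R^{\mathsf{PF}}_{\hat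 U})^{-1}\big\vert_{R^{\mathsf{PF}}_{\hat U}\left(T^{\perp}_{\hat U}\mathrm{St}(n,p)\right)}.$$
   Context: $\mathrm{St}(n,p)=\{U\in\mathbb{R}^{n\times p}\mid U^TU=I_p\}$ is the Stiefel manifold, $\mathrm{skew}(p)$ is the space of real skew-symmetric $p\times p$ matrices, $\exp_m$ is the matrix exponential, $\log_m$ is the matrix logarithm, and $(\cdot)^{-\frac12}$ is the inverse of the symmetric positive definite square root. Fix an orthogonal completion $\widehat{\mathbf{Q}}=[\hat U\ \ \hat U_\perp]\in O(n)$. Tangent vectors at $\hat U$ are $\xi=\widehat{\mathbf{Q}}\begin{bmatrix} A\\ B\end{bmatrix}=\hat UA+\hat U_\perp B$ with $A\in\mathrm{skew}(p)$, $B\in\mathbb{R}^{(n-p)\times p}$. The tangent space splits as $T_{\hat U}\mathrm{St}(n,p)=T^{\parallel}_{\hat U}\mathrm{St}(n,p)\oplus T^{\perp}_{\hat U}\mathrm{St}(n,p)$, where $T^{\parallel}_{\hat U}\mathrm{St}(n,p)=\{\hat UA\mid A\in\mathrm{skew}(p)\}$ and $T^{\perp}_{\hat U}\mathrm{St}(n,p)=\{\hat U_\perp B\mid B\in\mathbb{R}^{(n-p)\times p}\}$. Polar-light retraction: $$R^{\mathsf{PL}}_{\hat U}(\xi)=\widehat{\mathbf{Q}}\begin{bmatrix}\exp_m(A)\\ B\end{bmatrix}(I_p+B^TB)^{-\frac12},$$ with inverse map, on a neighborhood $\mathcal{B}_{\hat U}$ of $\hat U$ serving as chart domain, $$(R^{\mathsf{PL}}_{\hat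 U})^{-1}(U)=\hat U\log_m\!\left(\hat U^TU(U^T\hat U\hat U^TU)^{-\frac12}\right)+(I_n-\hat U\hat U^T)U(U^T\hat U\hat U^TU)^{-\frac12}.$$ Full polar factor retraction: $R^{\mathsf{PF}}_{\hat U}(\xi)=(\hat U+\xi)(I_p+A^TA+B^TB)^{-\frac12}$; $(R^{\mathsf{PF}}_{\hat U})^{-1}$ denotes its inverse. Riemannian exponential under the one-parameter family of $\beta$-metrics $\left\langle \widehat{\mathbf{Q}}\begin{bmatrix} A\\ B\end{bmatrix},\widehat{\mathbf{Q}}\begin{bmatrix}\tilde A\\ \tilde B\end{bmatrix}\right\rangle=\beta\,\mathrm{tr}(A^T\tilde A)+\mathrm{tr}(B^T\tilde B)$, $\beta>0$ (canonical metric for $\beta=\frac12$, Euclidean metric for $\beta=1$): $$\mathrm{Exp}_{\hat U}\!\left(\widehat{\mathbf{Q}}\begin{bmatrix} A\\ B\end{bmatrix}\right)=\widehat{\mathbf{Q}}\exp_m\!\left(\begin{bmatrix}2\beta A&-B^T\\ B&0\end{bmatrix}\right)\begin{bmatrix}I_p\\ 0\end{bmatrix}\exp_m((1-2\beta)A).$$ When restricted to $T^{\parallel}_{\hat U}\mathrm{St}(n,p)$ or to $T^{\perp}_{\hat U}\mathrm{St}(n,p)$, it is independent of $\beta$. $\mathrm{Log}_{\hat U}$, the Riemannian logarithm, is the inverse of $\mathrm{Exp}_{\hat U}$.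
   Formalization: In (i) the inverse equality is stated on images of the part of T^∥ in a domain D where Exp is injective, D being a geodesic ball or having parallel part with eigenvalues |Im z|<π (principal log_m), since Exp is not injective on all of T^∥ and log_m is undefined at eigenvalue -1. *)

theory Defs
  imports
    "HOL-Analysis.Analysis"
    "Jordan_Normal_Form.Gauss_Jordan_Elimination"
    "Jordan_Normal_Form.Char_Poly"
begin

text \<open>Matrices are the carrier-based ones of \<open>Jordan_Normal_Form\<close>, so that $n$ and $p$ are ordinary
  natural numbers and the square case $n = p$, in which $B$ and the orthogonal completion are empty
  matrices, is included.\<close>

section \<open>Matrix functions\<close>

definition skew :: "nat \<Rightarrow> real mat set" where
  "skew p = {A \<in> carrier_mat p p. A\<^sup>T = - A}"

definition spd :: "nat \<Rightarrow> real mat set" where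
  "spd p = {S \<in> carrier_mat p p. S\<^sup>T = S \<and> (\<forall>v \<in> carrier_vec p. v \<noteq> 0\<^sub>v p \<longrightarrow> v \<bullet> (S *\<^sub>v v) > 0)}"

definition mtrace :: "real mat \<Rightarrow> real" where
  "mtrace A = (\<Sum>i<dim_row A. A $$ (i, i))"

definition exp_m :: "real mat \<Rightarrow> real mat" where
  "exp_m A = mat (dim_row A) (dim_row A) (\<lambda>(i, j). \<Sum>k. (A ^\<^sub>m k) $$ (i, j) / fact k)"

definition in_principal_strip :: "real mat \<Rightarrow> bool" where
  "in_principal_strip A \<longleftrightarrow> (\<forall>z. eigenvalue (map_mat complex_of_real A) z \<longrightarrow> \<bar>Im z\<bar> < pi)"

text \<open>Principal logarithm: the logarithm all of whose eigenvalues lie in the open strip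
  $|\mathrm{Im}\, z| < \pi$. It exists, and is then unique, iff no eigenvalue of $M$ lies on the
  closed negative real axis; elsewhere the value is unspecified.\<close>

definition log_m :: "real mat \<Rightarrow> real mat" where
  "log_m M = (THE X. X \<in> carrier_mat (dim_row M) (dim_row M) \<and> exp_m X = M \<and> in_principal_strip X)"

definition spd_sqrt :: "real mat \<Rightarrow> real mat" where
  "spd_sqrt S = (THE X. X \<in> spd (dim_row S) \<and> X * X = S)"

definition inv_sqrt :: "real mat \<Rightarrow> real mat" where
  "inv_sqrt S = the (mat_inverse (spd_sqrt S))"

section \<open>The Stiefel manifold and its tangent spaces\<close>

definition St :: "nat \<Rightarrow> nat \<Rightarrow> real mat set" where
  "St n p = {U \<in> carrier_mat n p. U\<^sup>T * U = 1\<^sub>m p}"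

definition O_group :: "nat \<Rightarrow> real mat set" where
  "O_group n = {Q \<in> carrier_mat n n. Q\<^sup>T * Q = 1\<^sub>m n \<and> Q * Q\<^sup>T = 1\<^sub>m n}"

definition hcat :: "real mat \<Rightarrow> real mat \<Rightarrow> real mat" where
  "hcat X Y = four_block_mat X Y (0\<^sub>m 0 (dim_col X)) (0\<^sub>m 0 (dim_col Y))"

definition T_par :: "real mat \<Rightarrow> real mat set" where
  "T_par U = {U * A | A. A \<in> skew (dim_col U)}"

definition T_perp :: "real mat \<Rightarrow> real mat \<Rightarrow> real mat set" where
  "T_perp U Up = {Up * B | B. B \<in> carrier_mat (dim_col Up) (dim_col U)}"

definition T_St :: "real mat \<Rightarrow> real mat \<Rightarrow> real mat set" where
  "T_St U Up = {U * A + Up * B | A B.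
     A \<in> skew (dim_col U) \<and> B \<in> carrier_mat (dim_col Up) (dim_col U)}"

text \<open>When \<open>hcat U Up\<close> is orthogonal, the blocks of $\xi = \hat U A + \hat U_\perp B$ are recovered as
  $A = \hat U^T \xi$ and $B = \hat U_\perp^T \xi$. All maps below use this to take the tangent
  vector $\xi$ itself as their argument.\<close>

definition beta_metric :: "real \<Rightarrow> real mat \<Rightarrow> real mat \<Rightarrow> real mat \<Rightarrow> real mat \<Rightarrow> real" where
  "beta_metric \<beta> U Up \<xi> \<eta> =
     \<beta> * mtrace ((U\<^sup>T * \<xi>)\<^sup>T * (U\<^sup>T * \<eta>)) + mtrace ((Up\<^sup>T * \<xi>)\<^sup>T * (Up\<^sup>T * \<eta>))"

definition T_ball :: "real \<Rightarrow> real mat \<Rightarrow> real mat \<Rightarrow> real \<Rightarrow> real mat set" where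
  "T_ball \<beta> U Up r = {\<xi> \<in> T_St U Up. sqrt (beta_metric \<beta> U Up \<xi> \<xi>) < r}"

section \<open>Retractions, Riemannian exponential, and their inverses\<close>

definition R_PL :: "real mat \<Rightarrow> real mat \<Rightarrow> real mat \<Rightarrow> real mat" where
  "R_PL U Up \<xi> = (let A = U\<^sup>T * \<xi>; B = Up\<^sup>T * \<xi> in
     hcat U Up * (exp_m A @\<^sub>r B) * inv_sqrt (1\<^sub>m (dim_col U) + B\<^sup>T * B))"

definition R_PL_inv :: "real mat \<Rightarrow> real mat \<Rightarrow> real mat" where
  "R_PL_inv U V = (let S = inv_sqrt (V\<^sup>T * U * U\<^sup>T * V) in
     U * log_m (U\<^sup>T * V * S) + (1\<^sub>m (dim_row U) - U * U\<^sup>T) * V * S)"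

text \<open>The tangent vectors on which \<open>R_PL\<close> is inverted by the formula \<open>R_PL_inv\<close>, i.e. those for
  which $A$ is the principal logarithm of $\exp_m(A)$; the image of this set under \<open>R_PL\<close> is the
  largest chart domain on which the formula is meaningful.\<close>

definition R_PL_dom :: "real mat \<Rightarrow> real mat \<Rightarrow> real mat set" where
  "R_PL_dom U Up = {\<xi> \<in> T_St U Up. in_principal_strip (U\<^sup>T * \<xi>)}"

definition R_PF :: "real mat \<Rightarrow> real mat \<Rightarrow> real mat \<Rightarrow> real mat" where
  "R_PF U Up \<xi> = (let A = U\<^sup>T * \<xi>; B = Up\<^sup>T * \<xi> in
     (U + \<xi>) * inv_sqrt (1\<^sub>m (dim_col U) + A\<^sup>T * A + B\<^sup>T * B))"

text \<open>No choice of branch is involved here, since \<open>R_PF\<close> is injective on the whole tangent space: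
  if $M = \hat U^T R^{\mathsf{PF}}_{\hat U}(\xi)$, then $S = (I_p + A^TA + B^TB)^{1/2}$ is determined
  by $M S + S M^T = 2 I_p$.\<close>

definition R_PF_inv :: "real mat \<Rightarrow> real mat \<Rightarrow> real mat \<Rightarrow> real mat" where
  "R_PF_inv U Up = inv_into (T_St U Up) (R_PF U Up)"

definition Exp_St :: "real \<Rightarrow> real mat \<Rightarrow> real mat \<Rightarrow> real mat \<Rightarrow> real mat" where
  "Exp_St \<beta> U Up \<xi> = (let A = U\<^sup>T * \<xi>; B = Up\<^sup>T * \<xi>; p = dim_col U; q = dim_col Up in
     hcat U Up * exp_m (four_block_mat ((2 * \<beta>) \<cdot>\<^sub>m A) (- B\<^sup>T) B (0\<^sub>m q q))
       * (1\<^sub>m p @\<^sub>r 0\<^sub>m q p) * exp_m ((1 - 2 * \<beta>) \<cdot>\<^sub>m A))"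

text \<open>The exponential is only locally invertible. Its inverse depends on the set \<open>D\<close> of tangent
  vectors on which it is inverted, and \<open>Log_St\<close> is meaningful when the exponential is injective
  on \<open>D\<close>.\<close>

definition Log_St :: "real \<Rightarrow> real mat \<Rightarrow> real mat \<Rightarrow> real mat set \<Rightarrow> real mat \<Rightarrow> real mat" where
  "Log_St \<beta> U Up D = inv_into D (Exp_St \<beta> U Up)"

text \<open>The admissible domains of inversion are those on which the comparison with the principal
  matrix logarithm makes sense: either a geodesic normal ball of arbitrary radius (up to the
  injectivity radius), or any other set whose parallel part lies in the domain on which \<open>R_PL\<close>
  is inverted. The latter includes, e.g., the whole set \<open>T_par U \<inter> R_PL_dom U Up\<close>, which need not
  lie in any normal ball.\<close>

definition Log_domain :: "real \<Rightarrow> real mat \<Rightarrow> real mat \<Rightarrow> real mat set \<Rightarrow> bool" where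
  "Log_domain \<beta> U Up D \<longleftrightarrow> D \<subseteq> T_St U Up \<and> inj_on (Exp_St \<beta> U Up) D \<and>
     ((\<exists>r. D = T_ball \<beta> U Up r) \<or> T_par U \<inter> D \<subseteq> R_PL_dom U Up)"

end

theory Submission
  imports Defs "Jordan_Normal_Form.Spectral_Radius"
begin

text \<open>
  On a parallel vector \<open>U A\<close> the polar factor is the identity and both the polar-light retraction and the
  Riemannian exponential are \<open>U exp(A)\<close> (\<open>R_PL_par\<close>, \<open>Exp_par\<close>). On a perpendicular vector \<open>Up B\<close> the
  exponential factor is the identity and both retractions are \<open>(U + Up B) (1 + B\<^sup>T B)\<^sup>-\<^sup>1\<^sup>/\<^sup>2\<close>
  (\<open>R_PL_perp\<close>, \<open>R_PF_perp\<close>). The work lies in the inverse maps: on either part, each of the two inverses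
  has to return the tangent vector itself.

  For the parallel part, the Riemannian logarithm does so because the exponential is injective on the
  domain \<open>D\<close>, whereas the inverse formula of the polar-light retraction returns \<open>U log(exp(A))\<close>. This is
  \<open>U A\<close> if the eigenvalues of \<open>A\<close> lie in the strip \<open>\<bar>Im z\<bar> < \<pi>\<close>, by uniqueness of the principal
  logarithm among all real matrices (\<open>principal_log_unique\<close>). That the strip condition holds on every
  normal ball on which the exponential is injective is a cut locus argument: if the ball contained \<open>U A\<close>
  where \<open>A\<close> has an eigenvalue outside the strip, then \<open>A\<close> could be shrunk until it rotates some
  plane by the angle \<open>\<pi>\<close>, and reversing that rotation gives a second vector of the same length with the same image
  (\<open>exp_m_not_injective_outside_strip\<close>, \<open>normal_ball_in_strip\<close>).

  For the perpendicular part, the inverse formula is evaluated directly (\<open>R_PL_inv_perp\<close>), which requires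
  existence and uniqueness of the positive definite square root, and the inverse of the polar factor
  retraction is handled by its injectivity on the whole tangent space (\<open>R_PF_inj\<close>). Both uniqueness of
  the root and this injectivity are instances of the uniqueness of symmetric solutions of a Lyapunov
  equation (\<open>lyapunov_unique\<close>).

  All spectral arguments share one tool. A complex matrix without Jordan chains of length two has
  enough eigenvectors (\<open>semisimple_eigsum\<close>), and symmetric, skew-symmetric and orthogonal matrices are
  of this kind; matrix identities are then checked on eigenvectors, where they are identities between
  numbers.
\<close>

(* from here on, the inner product dot and the index $ refer to carrier-based vectors only *)
unbundle no inner_syntax
unbundle no vec_syntax

section \<open>Sums of eigenvectors\<close>

text \<open>The span of the eigenvectors, generated by adding one eigenvector at a time so that linear statements
  can be proved by induction over the summands.\<close>
inductive_set eigsum :: "complex mat \<Rightarrow> complex vec set" for A where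
  zero: "0\<^sub>v (dim_row A) \<in> eigsum A"
| add: "v \<in> eigsum A \<Longrightarrow> u \<in> carrier_vec (dim_row A) \<Longrightarrow> A *\<^sub>v u = \<mu> \<cdot>\<^sub>v u \<Longrightarrow> v + u \<in> eigsum A"

text \<open>The matrix is diagonalizable, expressed by the absence of Jordan chains of length two. In this form
  the property can be checked one vector at a time, for a given matrix by a computation with a
  suitable Hermitian form.\<close>
definition semisimple :: "complex mat \<Rightarrow> bool" where
  "semisimple A \<longleftrightarrow> (\<forall>\<mu>. \<forall>u \<in> carrier_vec (dim_row A). \<forall>w \<in> carrier_vec (dim_row A).
     A *\<^sub>v u = \<mu> \<cdot>\<^sub>v u + w \<longrightarrow> A *\<^sub>v w = \<mu> \<cdot>\<^sub>v w \<longrightarrow> w = 0\<^sub>v (dim_row A))"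

lemma semisimpleD:
  assumes "semisimple A" "A \<in> carrier_mat n n" "u \<in> carrier_vec n" "w \<in> carrier_vec n"
    "A *\<^sub>v u = \<mu> \<cdot>\<^sub>v u + w" "A *\<^sub>v w = \<mu> \<cdot>\<^sub>v w"
  shows "w = 0\<^sub>v n"
  using assms unfolding semisimple_def by (metis carrier_matD(1))

lemma eigsum_carrier: "v \<in> eigsum A \<Longrightarrow> v \<in> carrier_vec (dim_row A)"
  by (induction rule: eigsum.induct) auto

lemma eigsum_add:
  assumes "v \<in> eigsum A" "w \<in> eigsum A"
  shows "v + w \<in> eigsum A"
  using assms(2,1)
proof (induction rule: eigsum.induct)
  case zero
  then show ?case using eigsum_carrier[OF zero] by simp
next
  case (add x u \<mu>)
  have "v + (x + u) = (v + x) + u"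
    using add eigsum_carrier by (intro assoc_add_vec[symmetric, of _ "dim_row A"]) auto
  then show ?case using add eigsum.add by metis
qed

lemma eigenvector_eigsum:
  assumes "u \<in> carrier_vec (dim_row A)" "A *\<^sub>v u = \<mu> \<cdot>\<^sub>v u"
  shows "u \<in> eigsum A"
  using eigsum.add[OF eigsum.zero assms] assms by simp

lemma smult_eigenvector:
  assumes "A \<in> carrier_mat n n" "u \<in> carrier_vec n" "A *\<^sub>v u = \<mu> \<cdot>\<^sub>v (u :: complex vec)"
  shows "A *\<^sub>v (c \<cdot>\<^sub>v u) = \<mu> \<cdot>\<^sub>v (c \<cdot>\<^sub>v u)"
  using assms by (simp add: mult_mat_vec smult_smult_assoc mult.commute)

lemma eigsum_smult:
  assumes "A \<in> carrier_mat n n" "v \<in> eigsum A"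
  shows "c \<cdot>\<^sub>v v \<in> eigsum A"
  using assms(2)
proof (induction rule: eigsum.induct)
  case zero
  have "c \<cdot>\<^sub>v 0\<^sub>v (dim_row A) = 0\<^sub>v (dim_row A)" by (rule eq_vecI) auto
  then show ?case using eigsum.zero by simp
next
  case (add v u \<mu>)
  have "c \<cdot>\<^sub>v (v + u) = c \<cdot>\<^sub>v v + c \<cdot>\<^sub>v u"
    using add eigsum_carrier by (intro smult_add_distrib_vec[of _ "dim_row A"]) auto
  moreover have "A *\<^sub>v (c \<cdot>\<^sub>v u) = \<mu> \<cdot>\<^sub>v (c \<cdot>\<^sub>v u)"
    using add assms(1) by (intro smult_eigenvector[of _ n]) auto
  ultimately show ?case using add eigsum.add[of "c \<cdot>\<^sub>v v" A "c \<cdot>\<^sub>v u"] by auto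
qed

text \<open>Over a sum of eigenvectors of \<open>A\<close>, the \<open>\<rho>\<close>-eigenspace can be split off modulo the range
  of any \<open>F\<close> that acts by nonzero scalars on the other eigenvectors. It is used for
  \<open>F = A - \<rho>\<close>, and, in the uniqueness of the logarithm, for \<open>F = exp(A) - exp(\<rho>)\<close>.\<close>
lemma eigsum_peel:
  assumes A: "A \<in> carrier_mat n n" and F: "F \<in> carrier_mat n n" and v: "v \<in> eigsum A"
    and step: "\<And>u \<mu>. u \<in> carrier_vec n \<Longrightarrow> u \<noteq> 0\<^sub>v n \<Longrightarrow> A *\<^sub>v u = \<mu> \<cdot>\<^sub>v u \<Longrightarrow> \<mu> \<noteq> \<rho>
      \<Longrightarrow> \<exists>c. c \<noteq> 0 \<and> F *\<^sub>v u = c \<cdot>\<^sub>v u"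
  shows "\<exists>w \<in> carrier_vec n. \<exists>x \<in> eigsum A. A *\<^sub>v w = \<rho> \<cdot>\<^sub>v w \<and> v = w + F *\<^sub>v x"
  using v
proof (induction rule: eigsum.induct)
  case zero
  have "0\<^sub>v n \<in> eigsum A" using eigsum.zero[of A] A by simp
  moreover have "A *\<^sub>v 0\<^sub>v n = \<rho> \<cdot>\<^sub>v 0\<^sub>v n" "0\<^sub>v (dim_row A) = 0\<^sub>v n + F *\<^sub>v 0\<^sub>v n"
    using A F by (auto intro!: eq_vecI)
  ultimately show ?case by (intro bexI[of _ "0\<^sub>v n"]) auto
next
  case (add v u \<mu>)
  then obtain w x where w: "w \<in> carrier_vec n" "A *\<^sub>v w = \<rho> \<cdot>\<^sub>v w"
    and x: "x \<in> eigsum A" and v: "v = w + F *\<^sub>v x" by auto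
  have u: "u \<in> carrier_vec n" and xc: "x \<in> carrier_vec n"
    using add A x eigsum_carrier by auto
  have Fx: "F *\<^sub>v x \<in> carrier_vec n" using F xc by simp
  show ?case
  proof (cases "u = 0\<^sub>v n \<or> \<mu> = \<rho>")
    case True
    then have "A *\<^sub>v u = \<rho> \<cdot>\<^sub>v u"
      using add(3) A by (auto intro!: eq_vecI)
    then have "A *\<^sub>v (w + u) = \<rho> \<cdot>\<^sub>v (w + u)"
      using w u A by (simp add: mult_add_distrib_mat_vec smult_add_distrib_vec)
    moreover have "v + u = (w + u) + F *\<^sub>v x"
      unfolding v using w(1) u F by (intro eq_vecI) auto
    ultimately show ?thesis using w u x by (intro bexI[of _ "w + u"] bexI[of _ x]) auto
  next
    case False
    then obtain c where c: "c \<noteq> 0" "F *\<^sub>v u = c \<cdot>\<^sub>v u" using step u add by blast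
    let ?y = "(1 / c) \<cdot>\<^sub>v u"
    have "F *\<^sub>v (x + ?y) = F *\<^sub>v x + u"
      using F xc u c by (simp add: mult_add_distrib_mat_vec mult_mat_vec smult_smult_assoc)
    then have "v + u = w + F *\<^sub>v (x + ?y)"
      unfolding v using w(1) u Fx by (metis assoc_add_vec)
    moreover have "x + ?y \<in> eigsum A"
      using x u A add(3) by (intro eigsum.add[of _ _ _ \<mu>] smult_eigenvector[of _ n]) auto
    ultimately show ?thesis using w by (intro bexI[of _ w] bexI[of _ "x + ?y"]) auto
  qed
qed

text \<open>By Schur's theorem \<open>A\<close> is triangular in some basis, the columns of \<open>P\<close> below, and these columns are
  shown to be sums of eigenvectors one after the other. For the \<open>k\<close>-th one, \<open>A - B\<^sub>k\<^sub>k\<close> maps it to a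
  vector \<open>P z\<close> in the span of the previous columns, so \<open>P z = w + (A - B\<^sub>k\<^sub>k) x\<close> with \<open>w\<close> in the
  \<open>B\<^sub>k\<^sub>k\<close>-eigenspace. After subtraction of \<open>x\<close> from the column, the column and \<open>w\<close> form a Jordan chain,
  which forces \<open>w = 0\<close>.\<close>
lemma semisimple_eigsum:
  assumes A: "A \<in> carrier_mat n n" and ss: "semisimple A" and v: "v \<in> carrier_vec n"
  shows "v \<in> eigsum A"
proof -
  obtain es where "char_poly A = (\<Prod>a\<leftarrow>es. [:- a, 1:])"
    using char_poly_factorized[OF A] by blast
  then obtain B where B: "B \<in> carrier_mat n n" "upper_triangular B" "similar_mat A B"
    using schur_decomposition_exists[OF A] by blast
  then obtain P Q where w: "similar_mat_wit A B P Q" unfolding similar_mat_def by blast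
  note wit = similar_mat_witD2[OF A w]
  have P: "P \<in> carrier_mat n n" and Q: "Q \<in> carrier_mat n n" using wit by auto
  have AP: "A *\<^sub>v (P *\<^sub>v y) = P *\<^sub>v (B *\<^sub>v y)" if "y \<in> carrier_vec n" for y
  proof -
    have "A *\<^sub>v (P *\<^sub>v y) = (A * P) *\<^sub>v y" using A P that by simp
    also have "A * P = P * B * (Q * P)"
      unfolding wit(3) using P Q B by (simp add: assoc_mult_mat[of _ n n _ n _ n])
    also have "\<dots> = P * B" using wit(2) P B by simp
    finally show ?thesis using P B that by simp
  qed
  \<comment> \<open>The span of the first \<open>k\<close> columns of \<open>P\<close> consists of sums of eigenvectors.\<close>
  have flag: "k \<le> n \<Longrightarrow> \<forall>y \<in> carrier_vec n. (\<forall>i. k \<le> i \<and> i < n \<longrightarrow> y $ i = 0) \<longrightarrow> P *\<^sub>v y \<in> eigsum A" for k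
  proof (induction k)
    case 0
    have "P *\<^sub>v y \<in> eigsum A" if "y \<in> carrier_vec n" "\<forall>i<n. y $ i = 0" for y
    proof -
      have "y = 0\<^sub>v n" using that by (intro eq_vecI) auto
      then have "P *\<^sub>v y = 0\<^sub>v (dim_row A)" using P A by (auto intro!: eq_vecI)
      then show ?thesis using eigsum.zero[of A] by simp
    qed
    then show ?case by auto
  next
    case (Suc k)
    let ?e = "unit_vec n k :: complex vec" and ?\<rho> = "B $$ (k, k)"
    define z where "z = B *\<^sub>v ?e - ?\<rho> \<cdot>\<^sub>v ?e"
    define F where "F = A - ?\<rho> \<cdot>\<^sub>m 1\<^sub>m n"
    have Fv: "F *\<^sub>v y = A *\<^sub>v y - ?\<rho> \<cdot>\<^sub>v y" if "y \<in> carrier_vec n" for y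
      using A that by (auto simp: F_def minus_mult_distrib_mat_vec[of _ n n])
    have F: "F \<in> carrier_mat n n" unfolding F_def by (intro minus_carrier_mat) simp
    have kn: "k < n" using Suc by simp
    have e: "?e \<in> carrier_vec n" by simp
    have z: "z \<in> carrier_vec n" using B by (simp add: z_def)
    have "z $ i = 0" if "k \<le> i" "i < n" for i
    proof -
      have "(B *\<^sub>v ?e) $ i = B $$ (i, k)" using B that kn by simp
      then show ?thesis unfolding z_def
        using that kn B upper_triangularD[OF B(2), of k i] by (cases "i = k") auto
    qed
    then have Pz: "P *\<^sub>v z \<in> eigsum A" using Suc z by auto
    have FPe: "F *\<^sub>v (P *\<^sub>v ?e) = P *\<^sub>v z"
      using P B by (simp add: Fv AP z_def mult_minus_distrib_mat_vec[of _ n n] mult_mat_vec)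
    \<comment> \<open>split off the part of \<open>P *\<^sub>v z\<close> in the eigenspace of the new diagonal entry\<close>
    have "\<exists>w \<in> carrier_vec n. \<exists>x \<in> eigsum A. A *\<^sub>v w = ?\<rho> \<cdot>\<^sub>v w \<and> P *\<^sub>v z = w + F *\<^sub>v x"
    proof (rule eigsum_peel[OF A F Pz])
      fix u \<mu> assume u: "u \<in> carrier_vec n" "A *\<^sub>v u = \<mu> \<cdot>\<^sub>v u" "\<mu> \<noteq> ?\<rho>"
      then show "\<exists>c. c \<noteq> 0 \<and> F *\<^sub>v u = c \<cdot>\<^sub>v u"
        by (intro exI[of _ "\<mu> - ?\<rho>"]) (auto simp: Fv left_diff_distrib intro!: eq_vecI)
    qed
    then obtain w x where w: "w \<in> carrier_vec n" "A *\<^sub>v w = ?\<rho> \<cdot>\<^sub>v w"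
      and x: "x \<in> eigsum A" and Pzw: "P *\<^sub>v z = w + F *\<^sub>v x" by auto
    have xc: "x \<in> carrier_vec n" using x A eigsum_carrier by auto
    have Pe: "P *\<^sub>v ?e \<in> carrier_vec n" using P by simp
    define u where "u = P *\<^sub>v ?e - x"
    have u: "u \<in> carrier_vec n" using Pe xc by (simp add: u_def)
    have "F *\<^sub>v u = F *\<^sub>v (P *\<^sub>v ?e) - F *\<^sub>v x"
      unfolding u_def using F Pe xc by (simp add: mult_minus_distrib_mat_vec[of _ n n])
    also have "\<dots> = w"
      unfolding FPe Pzw using w(1) F xc by (intro eq_vecI) auto
    finally have "A *\<^sub>v u - ?\<rho> \<cdot>\<^sub>v u = w" using u by (simp add: Fv)
    then have Au: "A *\<^sub>v u = ?\<rho> \<cdot>\<^sub>v u + w" using u w(1) A by (auto intro!: eq_vecI)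
    then have "w = 0\<^sub>v n" using semisimpleD[OF ss A u w(1)] w(2) by simp
    then have "A *\<^sub>v u = ?\<rho> \<cdot>\<^sub>v u" using Au u by simp
    then have "u \<in> eigsum A" using u A by (intro eigenvector_eigsum) auto
    moreover have "P *\<^sub>v ?e = u + x" unfolding u_def using P Pe xc by (intro eq_vecI) auto
    ultimately have Pe_sum: "P *\<^sub>v ?e \<in> eigsum A" using eigsum_add x by simp
    show ?case
    proof (intro ballI impI)
      fix y :: "complex vec" assume y: "y \<in> carrier_vec n" "\<forall>i. Suc k \<le> i \<and> i < n \<longrightarrow> y $ i = 0"
      define y' where "y' = y - y $ k \<cdot>\<^sub>v ?e"
      have y': "y' \<in> carrier_vec n" using y by (simp add: y'_def)
      have "y' $ i = 0" if "k \<le> i" "i < n" for i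
        using y that by (cases "i = k") (auto simp: y'_def)
      then have "P *\<^sub>v y' \<in> eigsum A" using Suc y' by auto
      moreover have "y = y' + y $ k \<cdot>\<^sub>v ?e" unfolding y'_def using y by (intro eq_vecI) auto
      then have "P *\<^sub>v y = P *\<^sub>v y' + y $ k \<cdot>\<^sub>v (P *\<^sub>v ?e)"
        using P y' e by (metis mult_add_distrib_mat_vec mult_mat_vec smult_carrier_vec)
      ultimately show "P *\<^sub>v y \<in> eigsum A"
        using eigsum_add eigsum_smult[OF A Pe_sum] by simp
    qed
  qed
  have "v = P *\<^sub>v (Q *\<^sub>v v)" using wit(1) P Q v by (metis assoc_mult_mat_vec one_mult_mat_vec)
  moreover have "P *\<^sub>v (Q *\<^sub>v v) \<in> eigsum A" using flag[of n] mult_mat_vec_carrier[OF Q v] by auto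
  ultimately show ?thesis by simp
qed

section \<open>Real matrices acting on complex vectors\<close>

abbreviation cmat :: "real mat \<Rightarrow> complex mat" where
  "cmat \<equiv> map_mat complex_of_real"

lemma cmat_add: "A \<in> carrier_mat n m \<Longrightarrow> B \<in> carrier_mat n m \<Longrightarrow> cmat (A + B) = cmat A + cmat B"
  by (intro eq_matI) auto

lemma cmat_smult: "cmat (c \<cdot>\<^sub>m A) = of_real c \<cdot>\<^sub>m cmat A"
  by (intro eq_matI) auto

lemma cmat_mult_vec:
  assumes "A \<in> carrier_mat n m" "B \<in> carrier_mat m k" "u \<in> carrier_vec k"
  shows "cmat (A * B) *\<^sub>v u = cmat A *\<^sub>v (cmat B *\<^sub>v u)"
  using assms by (simp add: of_real_hom.mat_hom_mult[OF assms(1,2)] assoc_mult_mat_vec[of _ n m _ k])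

lemma cmat_smult_vec:
  assumes "A \<in> carrier_mat n m" "u \<in> carrier_vec m"
  shows "cmat (c \<cdot>\<^sub>m A) *\<^sub>v u = of_real c \<cdot>\<^sub>v (cmat A *\<^sub>v u)"
  using assms by (simp add: cmat_smult) (auto intro!: eq_vecI)

lemma cmat_add_vec:
  assumes "A \<in> carrier_mat n m" "B \<in> carrier_mat n m" "u \<in> carrier_vec m"
  shows "cmat (A + B) *\<^sub>v u = cmat A *\<^sub>v u + cmat B *\<^sub>v u"
  using assms by (simp add: cmat_add[OF assms(1,2)] add_mult_distrib_mat_vec[of _ n m])

lemma conjugate_cmat_mult_vec:
  assumes "A \<in> carrier_mat n m" "u \<in> carrier_vec m"
  shows "conjugate (cmat A *\<^sub>v u) = cmat A *\<^sub>v conjugate u"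
  using assms by (intro eq_vecI) (auto simp: scalar_prod_def)

lemma cmat_adjoint:
  assumes "A \<in> carrier_mat n m" "u \<in> carrier_vec m" "w \<in> carrier_vec n"
  shows "(cmat A *\<^sub>v u) \<bullet>c w = u \<bullet>c (cmat A\<^sup>T *\<^sub>v w)"
proof -
  have "u \<bullet>c (cmat A\<^sup>T *\<^sub>v w) = u \<bullet> ((cmat A)\<^sup>T *\<^sub>v conjugate w)"
    using assms by (simp add: conjugate_cmat_mult_vec[of _ m n] map_mat_transpose)
  also have "\<dots> = ((cmat A)\<^sup>T *\<^sub>v conjugate w) \<bullet> u"
    using assms by (intro comm_scalar_prod[of _ m]) auto
  also have "\<dots> = conjugate w \<bullet> (cmat A *\<^sub>v u)"
    using assms by (intro transpose_vec_mult_scalar[of _ n m]) auto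
  also have "\<dots> = (cmat A *\<^sub>v u) \<bullet>c w"
    using assms by (intro comm_scalar_prod[of _ n]) auto
  finally show ?thesis by simp
qed

lemma sesquilinear_simps:
  fixes u v w :: "complex vec"
  assumes "u \<in> carrier_vec n" "v \<in> carrier_vec n" "w \<in> carrier_vec n"
  shows "(c \<cdot>\<^sub>v u) \<bullet>c w = c * (u \<bullet>c w)" "u \<bullet>c (c \<cdot>\<^sub>v w) = cnj c * (u \<bullet>c w)"
    "(u + v) \<bullet>c w = u \<bullet>c w + v \<bullet>c w" "u \<bullet>c (v + w) = u \<bullet>c v + u \<bullet>c w"
  using assms
  by (auto simp: conjugate_smult_vec conjugate_add_vec[of _ n] add_scalar_prod_distrib[of _ n]
      scalar_prod_add_distrib[of _ n])

text \<open>Symmetric and skew-symmetric matrices are the cases \<open>\<sigma> = 1\<close> and \<open>\<sigma> = -1\<close>; treating them together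
  gives real and imaginary eigenvalues by the same computation of \<open>\<langle>A w, w\<rangle>\<close>.\<close>
lemma eigenvalue_sym_skew:
  assumes A: "A \<in> carrier_mat n n" "A\<^sup>T = \<sigma> \<cdot>\<^sub>m A"
    and w: "w \<in> carrier_vec n" "w \<noteq> 0\<^sub>v n" "cmat A *\<^sub>v w = \<mu> \<cdot>\<^sub>v w"
  shows "\<mu> = of_real \<sigma> * cnj \<mu>"
proof -
  have "\<mu> * (w \<bullet>c w) = (cmat A *\<^sub>v w) \<bullet>c w"
    using w by (simp add: sesquilinear_simps[of _ n])
  also have "\<dots> = w \<bullet>c (cmat (\<sigma> \<cdot>\<^sub>m A) *\<^sub>v w)"
    using cmat_adjoint[OF A(1) w(1,1)] A(2) by simp
  also have "\<dots> = of_real \<sigma> * cnj \<mu> * (w \<bullet>c w)"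
    using w A by (simp add: cmat_smult_vec[of _ n n] smult_smult_assoc sesquilinear_simps[of _ n])
  finally show ?thesis using w conjugate_square_eq_0_vec[OF w(1)] by simp
qed

text \<open>If \<open>A u = \<mu> u + w\<close> and \<open>A w = \<mu> w\<close>, then \<open>\<langle>A u, w\<rangle>\<close> equals \<open>\<mu> \<langle>u, w\<rangle> + \<langle>w, w\<rangle>\<close> on the one hand and,
  on moving \<open>A\<close> to the other side, \<open>\<mu> \<langle>u, w\<rangle>\<close> on the other hand.\<close>
lemma semisimple_sym_skew:
  assumes A: "A \<in> carrier_mat n n" "A\<^sup>T = \<sigma> \<cdot>\<^sub>m A"
  shows "semisimple (cmat A)"
  unfolding semisimple_def
proof (intro allI ballI impI)
  fix \<mu> u w
  assume "u \<in> carrier_vec (dim_row (cmat A))" "w \<in> carrier_vec (dim_row (cmat A))"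
    and Au: "cmat A *\<^sub>v u = \<mu> \<cdot>\<^sub>v u + w" and Aw: "cmat A *\<^sub>v w = \<mu> \<cdot>\<^sub>v w"
  then have u: "u \<in> carrier_vec n" and w: "w \<in> carrier_vec n" using A by auto
  show "w = 0\<^sub>v (dim_row (cmat A))"
  proof (rule ccontr)
    assume "w \<noteq> 0\<^sub>v (dim_row (cmat A))"
    then have w0: "w \<noteq> 0\<^sub>v n" using A by simp
    have "\<mu> * (u \<bullet>c w) + w \<bullet>c w = (cmat A *\<^sub>v u) \<bullet>c w"
      unfolding Au using u w by (simp add: sesquilinear_simps[of _ n])
    also have "\<dots> = u \<bullet>c (cmat (\<sigma> \<cdot>\<^sub>m A) *\<^sub>v w)"
      using cmat_adjoint[OF A(1) u w] A(2) by simp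
    also have "\<dots> = of_real \<sigma> * cnj \<mu> * (u \<bullet>c w)"
      using u w A Aw by (simp add: cmat_smult_vec[of _ n n] smult_smult_assoc sesquilinear_simps[of _ n])
    also have "\<dots> = \<mu> * (u \<bullet>c w)"
      using eigenvalue_sym_skew[OF A w w0 Aw] by simp
    finally show False using conjugate_square_eq_0_vec[OF w] w0 by simp
  qed
qed

lemma symmetric_eq_smult: "A\<^sup>T = A \<Longrightarrow> A\<^sup>T = (1::real) \<cdot>\<^sub>m A" 
proof -
  have "(1::real) \<cdot>\<^sub>m A = A" by (intro eq_matI) auto
  then show "A\<^sup>T = A \<Longrightarrow> A\<^sup>T = (1::real) \<cdot>\<^sub>m A" by simp
qed

lemma eigenvalue_sym_real:
  assumes "S \<in> carrier_mat n n" "S\<^sup>T = S"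
    and "w \<in> carrier_vec n" "w \<noteq> 0\<^sub>v n" "cmat S *\<^sub>v w = \<mu> \<cdot>\<^sub>v w"
  obtains r where "\<mu> = of_real r"
proof -
  have "\<mu> = cnj \<mu>" using eigenvalue_sym_skew[OF assms(1) symmetric_eq_smult assms(3-5)] assms(2) by simp
  then have "\<mu> = of_real (Re \<mu>)" by (auto simp: complex_eq_iff)
  then show ?thesis using that by blast
qed

text \<open>The way in which diagonalizability is used throughout: identities between matrices, such as
  \<open>X * X = S\<close> or the addition formula for the exponential, reduce to identities between scalars on
  the eigenvectors of one fixed matrix.\<close>
lemma semisimple_mat_eqI:
  assumes A: "A \<in> carrier_mat n n" "semisimple A"
    and F: "F \<in> carrier_mat n n" and G: "G \<in> carrier_mat n n"
    and eq: "\<And>u \<mu>. u \<in> carrier_vec n \<Longrightarrow> u \<noteq> 0\<^sub>v n \<Longrightarrow> A *\<^sub>v u = \<mu> \<cdot>\<^sub>v u \<Longrightarrow> F *\<^sub>v u = G *\<^sub>v u"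
  shows "F = G"
proof -
  have "F *\<^sub>v v = G *\<^sub>v v" if "v \<in> eigsum A" for v
    using that
  proof (induction rule: eigsum.induct)
    case zero
    then show ?case using A F G by (auto intro!: eq_vecI)
  next
    case (add v u \<mu>)
    have "F *\<^sub>v u = G *\<^sub>v u"
    proof (cases "u = 0\<^sub>v n")
      case True then show ?thesis using F G by (auto intro!: eq_vecI)
    qed (use add A eq in auto)
    then show ?case using add A eigsum_carrier[OF add(1)] F G
      by (auto simp: mult_add_distrib_mat_vec[of _ n n])
  qed
  then have *: "F *\<^sub>v v = G *\<^sub>v v" if "v \<in> carrier_vec n" for v
    using semisimple_eigsum[OF A that] by simp
  show ?thesis
  proof (rule eq_matI)
    fix i j assume ij: "i < dim_row G" "j < dim_col G"
    have "(F *\<^sub>v unit_vec n j) $ i = (G *\<^sub>v unit_vec n j) $ i" by (subst *) auto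
    then show "F $$ (i, j) = G $$ (i, j)" using ij F G by simp
  qed (use F G in auto)
qed

lemma real_semisimple_mat_eqI:
  assumes A: "A \<in> carrier_mat n n" "A\<^sup>T = \<sigma> \<cdot>\<^sub>m A"
    and F: "F \<in> carrier_mat n n" and G: "G \<in> carrier_mat n n"
    and eq: "\<And>u \<mu>. u \<in> carrier_vec n \<Longrightarrow> u \<noteq> 0\<^sub>v n \<Longrightarrow> cmat A *\<^sub>v u = \<mu> \<cdot>\<^sub>v u \<Longrightarrow> cmat F *\<^sub>v u = cmat G *\<^sub>v u"
  shows "F = G"
proof -
  have "cmat F = cmat G"
    using A F G eq by (intro semisimple_mat_eqI[OF _ semisimple_sym_skew[OF A]]) auto
  then show ?thesis by (rule of_real_hom.mat_hom_inj)
qed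

section \<open>Functions of a symmetric matrix\<close>

text \<open>Newton's scheme: a new node \<open>a\<close> is added by correcting with a multiple of the polynomial that
  vanishes at the old nodes.\<close>
lemma poly_interpolation:
  fixes f :: "'a::field \<Rightarrow> 'a"
  assumes "finite X"
  shows "\<exists>q. \<forall>x\<in>X. poly q x = f x"
  using assms
proof (induction X)
  case (insert a X)
  then obtain q where q: "\<forall>x\<in>X. poly q x = f x" by blast
  define r where "r = (\<Prod>x\<in>X. [:- x, 1:])"
  have r: "poly r y = (\<Prod>x\<in>X. y - x)" for y by (simp add: r_def poly_prod)
  have ra: "poly r a \<noteq> 0" using insert by (auto simp: r)
  have "poly r x = 0" if "x \<in> X" for x using that insert by (auto simp: r)
  then have "\<forall>x\<in>insert a X. poly (q + Polynomial.smult ((f a - poly q a) / poly r a) r) x = f x"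
    using q ra by auto
  then show ?case by blast
qed simp

lemma symmetric_poly:
  assumes S: "S \<in> carrier_mat n n" "S\<^sup>T = S"
  shows "\<exists>F \<in> carrier_mat n n. F\<^sup>T = F \<and> S * F = F * S \<and>
    (\<forall>u \<in> carrier_vec n. \<forall>r. cmat S *\<^sub>v u = of_real r \<cdot>\<^sub>v u \<longrightarrow> cmat F *\<^sub>v u = of_real (poly q r) \<cdot>\<^sub>v u)"
proof (induction q)
  case 0
  show ?case using S by (intro bexI[of _ "0\<^sub>m n n"]) (auto intro!: eq_vecI simp: scalar_prod_def)
next
  case (pCons a q)
  then obtain F where F: "F \<in> carrier_mat n n" "F\<^sup>T = F" "S * F = F * S"
    and Fu: "\<And>u r. u \<in> carrier_vec n \<Longrightarrow> cmat S *\<^sub>v u = of_real r \<cdot>\<^sub>v u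
      \<Longrightarrow> cmat F *\<^sub>v u = of_real (poly q r) \<cdot>\<^sub>v u" by blast
  define G where "G = a \<cdot>\<^sub>m 1\<^sub>m n + S * F"
  have G: "G \<in> carrier_mat n n" using S F by (simp add: G_def)
  have "(S * F)\<^sup>T = F\<^sup>T * S\<^sup>T" using S(1) F(1) by (rule transpose_mult)
  then have "(S * F)\<^sup>T = S * F" unfolding S(2) F(2) F(3) .
  moreover have "(a \<cdot>\<^sub>m 1\<^sub>m n)\<^sup>T = a \<cdot>\<^sub>m 1\<^sub>m n" by (intro eq_matI) auto
  ultimately have "G\<^sup>T = G"
    unfolding G_def using S(1) F(1) by (simp add: transpose_add[of _ n n])
  moreover have "S * G = G * S"
  proof -
    have "S * (S * F) = S * (F * S)" using F(3) by simp
    also have "\<dots> = (S * F) * S" using S(1) F(1) by (intro assoc_mult_mat[symmetric])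
    finally show ?thesis unfolding G_def using S(1) F(1)
      by (simp add: mult_add_distrib_mat[of _ n n _ n] add_mult_distrib_mat[of _ n n _ _ n]
          mult_smult_distrib[of _ n n _ n] mult_smult_assoc_mat[of _ n n _ n])
  qed
  moreover have "cmat G *\<^sub>v u = of_real (poly (pCons a q) r) \<cdot>\<^sub>v u"
    if u: "u \<in> carrier_vec n" "cmat S *\<^sub>v u = of_real r \<cdot>\<^sub>v u" for u r
  proof -
    have "cmat G *\<^sub>v u = of_real a \<cdot>\<^sub>v u + cmat S *\<^sub>v (of_real (poly q r) \<cdot>\<^sub>v u)"
      unfolding G_def using S(1) F(1) u(1) Fu[OF u]
      by (simp add: cmat_add_vec[of _ n n] cmat_smult_vec[of _ n n] cmat_mult_vec[of _ n n _ n]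
          of_real_hom.mat_hom_one)
    also have "\<dots> = of_real (poly (pCons a q) r) \<cdot>\<^sub>v u"
      using S u by (simp add: mult_mat_vec[of _ n n] smult_smult_assoc)
        (auto intro!: eq_vecI simp: algebra_simps)
    finally show ?thesis .
  qed
  ultimately show ?case using G by blast
qed

text \<open>Functional calculus without a choice of eigenbasis: \<open>F\<close> is a polynomial in \<open>S\<close> that interpolates \<open>f\<close>
  on the finite spectrum, hence it is real and symmetric. It supplies the square root of a positive
  definite matrix and the sign changes in \<open>exp_m_not_injective_outside_strip\<close>.\<close>
lemma symmetric_function:
  fixes f :: "real \<Rightarrow> real"
  assumes S: "S \<in> carrier_mat n n" "S\<^sup>T = S"
  obtains F where "F \<in> carrier_mat n n" "F\<^sup>T = F"
    "\<And>u r. u \<in> carrier_vec n \<Longrightarrow> cmat S *\<^sub>v u = of_real r \<cdot>\<^sub>v u \<Longrightarrow> cmat F *\<^sub>v u = of_real (f r) \<cdot>\<^sub>v u"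
proof -
  have "finite (complex_of_real -` spectrum (cmat S))"
    using S by (intro finite_vimageI card_finite_spectrum(1)[of _ n]) (auto simp: inj_def)
  then obtain q where q: "\<And>r. of_real r \<in> spectrum (cmat S) \<Longrightarrow> poly q r = f r"
    using poly_interpolation[of _ f] by (metis vimageI2)
  obtain F where F: "F \<in> carrier_mat n n" "F\<^sup>T = F"
    and Fu: "\<And>u r. u \<in> carrier_vec n \<Longrightarrow> cmat S *\<^sub>v u = of_real r \<cdot>\<^sub>v u
      \<Longrightarrow> cmat F *\<^sub>v u = of_real (poly q r) \<cdot>\<^sub>v u" using symmetric_poly[OF S] by metis
  have "cmat F *\<^sub>v u = of_real (f r) \<cdot>\<^sub>v u"
    if u: "u \<in> carrier_vec n" "cmat S *\<^sub>v u = of_real r \<cdot>\<^sub>v u" for u r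
  proof (cases "u = 0\<^sub>v n")
    case True
    then show ?thesis using F by (auto intro!: eq_vecI)
  next
    case False
    then have "of_real r \<in> spectrum (cmat S)"
      using u S unfolding spectrum_def eigenvalue_def eigenvector_def by auto
    then show ?thesis using Fu[OF u] q by simp
  qed
  then show ?thesis using F that by blast
qed

section \<open>Symmetric positive definite matrices\<close>

lemma spdD:
  assumes "S \<in> spd n"
  shows "S \<in> carrier_mat n n" "S\<^sup>T = S"
    and "\<And>v. v \<in> carrier_vec n \<Longrightarrow> v \<noteq> 0\<^sub>v n \<Longrightarrow> v \<bullet> (S *\<^sub>v v) > 0"
    and "\<And>v. v \<in> carrier_vec n \<Longrightarrow> v \<bullet> (S *\<^sub>v v) \<ge> 0"
proof -
  show *: "S \<in> carrier_mat n n" "S\<^sup>T = S"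
    "\<And>v. v \<in> carrier_vec n \<Longrightarrow> v \<noteq> 0\<^sub>v n \<Longrightarrow> v \<bullet> (S *\<^sub>v v) > 0"
    using assms by (auto simp: spd_def)
  show "v \<bullet> (S *\<^sub>v v) \<ge> 0" if "v \<in> carrier_vec n" for v
    using *(1) *(3)[OF that] that by (cases "v = 0\<^sub>v n") (auto simp: less_imp_le)
qed

lemma spdI:
  assumes "S \<in> carrier_mat n n" "S\<^sup>T = S"
    and "\<And>v. v \<in> carrier_vec n \<Longrightarrow> v \<noteq> 0\<^sub>v n \<Longrightarrow> v \<bullet> (S *\<^sub>v v) > 0"
  shows "S \<in> spd n"
  using assms by (auto simp: spd_def)

lemma spd_one: "1\<^sub>m n \<in> spd n"
proof (rule spdI)
  fix v :: "real vec" assume "v \<in> carrier_vec n" "v \<noteq> 0\<^sub>v n"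
  then show "v \<bullet> (1\<^sub>m n *\<^sub>v v) > 0"
    using conjugate_square_greater_0_vec[of v n] by simp
qed auto

lemma spd_add_psd:
  assumes "S \<in> spd n" and P: "P \<in> carrier_mat n n" "P\<^sup>T = P"
    and psd: "\<And>v. v \<in> carrier_vec n \<Longrightarrow> v \<bullet> (P *\<^sub>v v) \<ge> 0"
  shows "S + P \<in> spd n"
proof (rule spdI)
  note S = spdD[OF assms(1)]
  show "S + P \<in> carrier_mat n n" using S P by simp
  show "(S + P)\<^sup>T = S + P" using S P by (simp add: transpose_add[of _ n n])
  fix v :: "real vec" assume v: "v \<in> carrier_vec n" "v \<noteq> 0\<^sub>v n"
  have "v \<bullet> ((S + P) *\<^sub>v v) = v \<bullet> (S *\<^sub>v v) + v \<bullet> (P *\<^sub>v v)"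
    using S P v by (simp add: add_mult_distrib_mat_vec[of _ n n] scalar_prod_add_distrib[of _ n])
  then show "v \<bullet> ((S + P) *\<^sub>v v) > 0" using S(3)[OF v] psd[OF v(1)] by simp
qed

lemma spd_add: "S \<in> spd n \<Longrightarrow> T \<in> spd n \<Longrightarrow> S + T \<in> spd n"
  by (intro spd_add_psd) (auto dest: spdD)

lemma gram_form:
  assumes "B \<in> carrier_mat m n" "v \<in> carrier_vec n"
  shows "v \<bullet> ((B\<^sup>T * B) *\<^sub>v v) = (B *\<^sub>v v) \<bullet> (B *\<^sub>v (v :: real vec))"
proof -
  have "v \<bullet> ((B\<^sup>T * B) *\<^sub>v v) = (B\<^sup>T *\<^sub>v (B *\<^sub>v v)) \<bullet> v"
    using assms by (simp add: assoc_mult_mat_vec[of _ n m _ n] comm_scalar_prod[of v n])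
  also have "\<dots> = (B *\<^sub>v v) \<bullet> (B *\<^sub>v v)"
    using assms by (intro transpose_vec_mult_scalar[of _ m n]) auto
  finally show ?thesis .
qed

lemma gram_sym: "B \<in> carrier_mat m n \<Longrightarrow> (B\<^sup>T * B)\<^sup>T = B\<^sup>T * (B :: real mat)"
  by (simp add: transpose_mult[of _ n m _ n])

lemma spd_add_gram:
  assumes "S \<in> spd n" "B \<in> carrier_mat m n"
  shows "S + B\<^sup>T * B \<in> spd n"
proof (rule spd_add_psd[OF assms(1)])
  fix v :: "real vec" assume "v \<in> carrier_vec n"
  then show "v \<bullet> ((B\<^sup>T * B) *\<^sub>v v) \<ge> 0"
    using gram_form[OF assms(2), of v] conjugate_square_ge_0_vec[of "B *\<^sub>v v"] by simp
qed (use assms gram_sym in auto)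

lemma spd_invertible:
  assumes "S \<in> spd n"
  obtains W where "mat_inverse S = Some W" "W \<in> carrier_mat n n" "S * W = 1\<^sub>m n" "W * S = 1\<^sub>m n"
proof -
  note S = spdD[OF assms]
  have "det S \<noteq> 0"
  proof
    assume "det S = 0"
    then obtain v where v: "v \<in> carrier_vec n" "v \<noteq> 0\<^sub>v n" "S *\<^sub>v v = 0\<^sub>v n"
      using det_0_iff_vec_prod_zero_field[OF S(1)] by blast
    then show False using S(3)[OF v(1,2)] by simp
  qed
  then have "S \<in> Units (ring_mat TYPE(real) n ())" by (rule det_non_zero_imp_unit[OF S(1)])
  then obtain W where "mat_inverse S = Some W"
    using mat_inverse(1)[OF S(1), where b = "()"] by (cases "mat_inverse S") auto
  then show ?thesis using mat_inverse(2)[OF S(1)] that by blast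
qed

lemma inverse_sym:
  assumes S: "S \<in> carrier_mat n n" "S\<^sup>T = S" and W: "W \<in> carrier_mat n n" "W * S = 1\<^sub>m n" "S * W = 1\<^sub>m n"
  shows "W\<^sup>T = (W :: real mat)"
proof -
  have WT: "W\<^sup>T \<in> carrier_mat n n" using W by simp
  have "(S * W)\<^sup>T = W\<^sup>T * S\<^sup>T" using S(1) W(1) by (rule transpose_mult)
  then have 1: "W\<^sup>T * S = 1\<^sub>m n" using S(2) W(3) by simp
  have "W\<^sup>T = W\<^sup>T * (S * W)" using W WT by simp
  also have "\<dots> = (W\<^sup>T * S) * W" using S(1) W(1) WT by (intro assoc_mult_mat[symmetric])
  finally show ?thesis using 1 W(1) by simp
qed

lemma spd_inverse:
  assumes "S \<in> spd n" and W: "W \<in> carrier_mat n n" "W * S = 1\<^sub>m n" "S * W = 1\<^sub>m n"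
  shows "W \<in> spd n"
proof (rule spdI)
  note S = spdD[OF assms(1)]
  show "W \<in> carrier_mat n n" by fact
  show "W\<^sup>T = W" using inverse_sym[OF S(1,2) W] .
  fix v :: "real vec" assume v: "v \<in> carrier_vec n" "v \<noteq> 0\<^sub>v n"
  have v': "v = S *\<^sub>v (W *\<^sub>v v)" using S(1) W v by (metis assoc_mult_mat_vec one_mult_mat_vec)
  have Wv: "W *\<^sub>v v \<in> carrier_vec n" using W v by simp
  have "W *\<^sub>v v \<noteq> 0\<^sub>v n" using v v' S(1) by auto
  from S(3)[OF Wv this] have "(W *\<^sub>v v) \<bullet> v > 0" using v' by simp
  then show "v \<bullet> (W *\<^sub>v v) > 0" using comm_scalar_prod[OF v(1) Wv] by simp
qed

text \<open>The Hermitian form at \<open>x + \<i> y\<close> has the real part \<open>x\<^sup>T S x + y\<^sup>T S y\<close>.\<close>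
lemma spd_complex_form:
  assumes "S \<in> spd n" and u: "u \<in> carrier_vec n" "u \<noteq> 0\<^sub>v n"
  shows "Re ((cmat S *\<^sub>v u) \<bullet>c u) > 0"
proof -
  note S = spdD[OF assms(1)]
  define x where "x = map_vec Re u"
  define y where "y = map_vec Im u"
  have xy: "x \<in> carrier_vec n" "y \<in> carrier_vec n" using u by (auto simp: x_def y_def)
  have dims: "dim_vec u = n" "dim_row S = n" "dim_col S = n" using u S by auto
  have "(cmat S *\<^sub>v u) \<bullet>c u = (\<Sum>i\<in>{0..<n}. (\<Sum>j\<in>{0..<n}. of_real (S $$ (i, j)) * u $ j) * cnj (u $ i))"
    using dims by (simp add: scalar_prod_def)
  then have "Re ((cmat S *\<^sub>v u) \<bullet>c u) =
      (\<Sum>i\<in>{0..<n}. (\<Sum>j\<in>{0..<n}. S $$ (i, j) * Re (u $ j)) * Re (u $ i)) +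
      (\<Sum>i\<in>{0..<n}. (\<Sum>j\<in>{0..<n}. S $$ (i, j) * Im (u $ j)) * Im (u $ i))"
    unfolding sum.distrib[symmetric] by (simp only: Re_sum) (simp add: algebra_simps)
  also have "\<dots> = x \<bullet> (S *\<^sub>v x) + y \<bullet> (S *\<^sub>v y)"
    using dims by (simp add: x_def y_def scalar_prod_def mult.commute)
  finally have "Re ((cmat S *\<^sub>v u) \<bullet>c u) = x \<bullet> (S *\<^sub>v x) + y \<bullet> (S *\<^sub>v y)" .
  moreover have "x \<noteq> 0\<^sub>v n \<or> y \<noteq> 0\<^sub>v n"
  proof (rule ccontr)
    assume "\<not> ?thesis"
    then have "x $ i = 0" "y $ i = 0" if "i < n" for i using that by auto
    then have "u = 0\<^sub>v n" using u by (intro eq_vecI) (auto simp: x_def y_def complex_eq_iff)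
    then show False using u by simp
  qed
  ultimately show ?thesis
    using S(3)[of x] S(3)[of y] S(4)[of x] S(4)[of y] xy
    by (metis add_pos_nonneg add_nonneg_pos)
qed

lemma spd_eigenvalue:
  assumes "S \<in> spd n" and u: "u \<in> carrier_vec n" "u \<noteq> 0\<^sub>v n" "cmat S *\<^sub>v u = \<mu> \<cdot>\<^sub>v u"
  obtains r where "\<mu> = of_real r" "r > 0"
proof -
  note S = spdD[OF assms(1)]
  obtain r where r: "\<mu> = of_real r" using eigenvalue_sym_real[OF S(1,2) u] .
  have "Re ((cmat S *\<^sub>v u) \<bullet>c u) = r * Re (u \<bullet>c u)"
    using u r by (simp add: sesquilinear_simps[of _ n])
  moreover have "Re (u \<bullet>c u) > 0"
    using spd_complex_form[OF spd_one u(1,2)] u by (simp add: of_real_hom.mat_hom_one)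
  ultimately have "r > 0" using spd_complex_form[OF assms(1) u(1,2)]
    by (simp add: zero_less_mult_iff)
  then show ?thesis using r that by blast
qed

lemma spd_sqrt_exists:
  assumes "S \<in> spd n"
  shows "\<exists>X \<in> spd n. X * X = S"
proof -
  note S = spdD[OF assms]
  obtain X where X: "X \<in> carrier_mat n n" "X\<^sup>T = X"
    and Xu: "\<And>u r. u \<in> carrier_vec n \<Longrightarrow> cmat S *\<^sub>v u = of_real r \<cdot>\<^sub>v u \<Longrightarrow> cmat X *\<^sub>v u = of_real (sqrt r) \<cdot>\<^sub>v u"
    by (rule symmetric_function[OF S(1,2), of sqrt]) blast
  \<comment> \<open>positivity of the root is seen from its own root, \<open>X = Y * Y = Y\<^sup>T * Y\<close>\<close>
  obtain Y where Y: "Y \<in> carrier_mat n n" "Y\<^sup>T = Y"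
    and Yu: "\<And>u r. u \<in> carrier_vec n \<Longrightarrow> cmat S *\<^sub>v u = of_real r \<cdot>\<^sub>v u \<Longrightarrow> cmat Y *\<^sub>v u = of_real (sqrt (sqrt r)) \<cdot>\<^sub>v u"
    by (rule symmetric_function[OF S(1,2), of "\<lambda>r. sqrt (sqrt r)"]) blast
  have XX: "X * X = S"
  proof (rule real_semisimple_mat_eqI[OF S(1) symmetric_eq_smult[OF S(2)]])
    fix u \<mu> assume u: "u \<in> carrier_vec n" "u \<noteq> 0\<^sub>v n" "cmat S *\<^sub>v u = \<mu> \<cdot>\<^sub>v u"
    then obtain r where r: "\<mu> = of_real r" "r > 0" using spd_eigenvalue[OF assms] by metis
    have "cmat (X * X) *\<^sub>v u = of_real (sqrt r * sqrt r) \<cdot>\<^sub>v u"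
      using X u r Xu[of u r] by (simp add: cmat_mult_vec[of _ n n _ n] mult_mat_vec[of _ n n] smult_smult_assoc
          del: real_sqrt_mult_self)
    then show "cmat (X * X) *\<^sub>v u = cmat S *\<^sub>v u" using u r by simp
  qed (use X S in auto)
  have YY: "Y * Y = X"
  proof (rule real_semisimple_mat_eqI[OF S(1) symmetric_eq_smult[OF S(2)]])
    fix u \<mu> assume u: "u \<in> carrier_vec n" "u \<noteq> 0\<^sub>v n" "cmat S *\<^sub>v u = \<mu> \<cdot>\<^sub>v u"
    then obtain r where r: "\<mu> = of_real r" "r > 0" using spd_eigenvalue[OF assms] by metis
    have "cmat (Y * Y) *\<^sub>v u = of_real (sqrt (sqrt r) * sqrt (sqrt r)) \<cdot>\<^sub>v u"
      using Y u r Yu[of u r] by (simp add: cmat_mult_vec[of _ n n _ n] mult_mat_vec[of _ n n] smult_smult_assoc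
          del: real_sqrt_mult_self)
    then show "cmat (Y * Y) *\<^sub>v u = cmat X *\<^sub>v u" using u r Xu[of u r] by simp
  qed (use X Y in auto)
  have "X \<in> spd n"
  proof (rule spdI[OF X])
    fix v :: "real vec" assume v: "v \<in> carrier_vec n" "v \<noteq> 0\<^sub>v n"
    have "Y *\<^sub>v v \<noteq> 0\<^sub>v n"
    proof
      assume "Y *\<^sub>v v = 0\<^sub>v n"
      then have "X *\<^sub>v v = 0\<^sub>v n"
        using Y v by (simp add: assoc_mult_mat_vec[of _ n n _ n] flip: YY) (auto intro!: eq_vecI)
      then have "S *\<^sub>v v = 0\<^sub>v n"
        using X v by (simp add: assoc_mult_mat_vec[of _ n n _ n] flip: XX) (auto intro!: eq_vecI)
      then show False using S(3)[OF v] v by simp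
    qed
    then have "(Y *\<^sub>v v) \<bullet> (Y *\<^sub>v v) > 0"
      using conjugate_square_greater_0_vec[of "Y *\<^sub>v v" n] Y v by simp
    then show "v \<bullet> (X *\<^sub>v v) > 0" using gram_form[OF Y(1) v(1)] Y YY by simp
  qed
  then show ?thesis using XX by blast
qed

text \<open>The Lyapunov operator \<open>D \<mapsto> M D + D M\<^sup>T\<close> has no kernel among symmetric matrices if it
  maps some positive definite \<open>S\<close> to a positive definite matrix. With \<open>N = S\<inverse> D\<close>, which is
  self-adjoint for the inner product given by \<open>S\<close>, an eigenvector \<open>N v = \<mu> v\<close> satisfies
  \<open>0 = \<langle>(M D + D M\<^sup>T) v, v\<rangle> = \<mu> \<langle>(M S + S M\<^sup>T) v, v\<rangle>\<close>, hence \<open>\<mu> = 0\<close>; and \<open>N\<close>, being diagonalizable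
  with all eigenvalues \<open>0\<close>, vanishes. This one fact yields both the uniqueness of the square root
  and the injectivity of the polar factor retraction.\<close>
lemma lyapunov_unique:
  assumes M: "M \<in> carrier_mat n n" and D: "D \<in> carrier_mat n n" "D\<^sup>T = D" and "S \<in> spd n"
    and Q: "M * S + S * M\<^sup>T \<in> spd n" and MD: "M * D + D * M\<^sup>T = 0\<^sub>m n n"
  shows "D = 0\<^sub>m n n"
proof -
  note S = spdD[OF \<open>S \<in> spd n\<close>]
  obtain W where W: "W \<in> carrier_mat n n" "S * W = 1\<^sub>m n" "W * S = 1\<^sub>m n"
    using spd_invertible[OF \<open>S \<in> spd n\<close>] by metis
  define N where "N = W * D"
  have N: "N \<in> carrier_mat n n" using W D by (simp add: N_def)
  have "S * N = (S * W) * D"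
    unfolding N_def using S(1) W(1) D(1) by (intro assoc_mult_mat[symmetric])
  then have SN: "S * N = D" using W D by simp
  have Dv: "cmat D *\<^sub>v v = cmat S *\<^sub>v (cmat N *\<^sub>v v)" if "v \<in> carrier_vec n" for v
    using cmat_mult_vec[OF S(1) N that] SN by simp
  \<comment> \<open>eigenvectors of \<open>N\<close> solve the generalized eigenvalue problem \<open>D v = \<mu> S v\<close>\<close>
  have eig0: "\<mu> = 0" if v: "v \<in> carrier_vec n" "v \<noteq> 0\<^sub>v n" and Nv: "cmat N *\<^sub>v v = \<mu> \<cdot>\<^sub>v v" for \<mu> v
  proof -
    have MT: "M\<^sup>T \<in> carrier_mat n n" using M by simp
    have Dv: "cmat D *\<^sub>v v = \<mu> \<cdot>\<^sub>v (cmat S *\<^sub>v v)"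
      using Dv[OF v(1)] Nv S(1) v by (simp add: mult_mat_vec[of _ n n])
    have c: "cmat S *\<^sub>v v \<in> carrier_vec n" "cmat M\<^sup>T *\<^sub>v v \<in> carrier_vec n" using S(1) MT v by auto
    let ?s = "(cmat S *\<^sub>v v) \<bullet>c v"
    have s: "v \<bullet>c (cmat S *\<^sub>v v) = ?s" using cmat_adjoint[OF S(1) v(1,1)] S(2) by simp
    have s0: "?s \<noteq> 0" using spd_complex_form[OF \<open>S \<in> spd n\<close> v] by auto
    have "\<mu> * ?s = (cmat D *\<^sub>v v) \<bullet>c v" using c v by (simp add: Dv sesquilinear_simps[of _ n])
    also have "\<dots> = v \<bullet>c (cmat D *\<^sub>v v)" using cmat_adjoint[OF D(1) v(1,1)] D(2) by simp
    also have "\<dots> = cnj \<mu> * ?s" using c v s by (simp add: Dv sesquilinear_simps[of _ n])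
    finally have real: "cnj \<mu> = \<mu>" using s0 by simp
    let ?t = "v \<bullet>c (cmat M\<^sup>T *\<^sub>v v)"
    have "0 = (cmat (M * D + D * M\<^sup>T) *\<^sub>v v) \<bullet>c v"
      unfolding MD using v by (simp add: scalar_prod_def)
    also have "\<dots> = (cmat M *\<^sub>v (cmat D *\<^sub>v v)) \<bullet>c v + (cmat D *\<^sub>v (cmat M\<^sup>T *\<^sub>v v)) \<bullet>c v"
      using M MT D v by (simp add: cmat_add_vec[of _ n n] cmat_mult_vec[of _ n n _ n] sesquilinear_simps[of _ n])
    also have "\<dots> = (cmat D *\<^sub>v v) \<bullet>c (cmat M\<^sup>T *\<^sub>v v) + (cmat M\<^sup>T *\<^sub>v v) \<bullet>c (cmat D *\<^sub>v v)"
      using cmat_adjoint[OF M _ v(1), of "cmat D *\<^sub>v v"] cmat_adjoint[OF D(1) c(2) v(1)] D v by simp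
    also have "\<dots> = \<mu> * ((cmat S *\<^sub>v v) \<bullet>c (cmat M\<^sup>T *\<^sub>v v) + (cmat M\<^sup>T *\<^sub>v v) \<bullet>c (cmat S *\<^sub>v v))"
      using c real by (simp add: Dv sesquilinear_simps[of _ n] algebra_simps)
    also have "\<dots> = \<mu> * ((cmat M *\<^sub>v (cmat S *\<^sub>v v)) \<bullet>c v + (cmat S *\<^sub>v (cmat M\<^sup>T *\<^sub>v v)) \<bullet>c v)"
      using cmat_adjoint[OF M c(1) v(1)] cmat_adjoint[OF S(1) c(2) v(1)] S(2) by simp
    also have "\<dots> = \<mu> * ((cmat (M * S + S * M\<^sup>T) *\<^sub>v v) \<bullet>c v)"
      using M MT S(1) v by (simp add: cmat_add_vec[of _ n n] cmat_mult_vec[of _ n n _ n] sesquilinear_simps[of _ n])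
    finally show "\<mu> = 0" using spd_complex_form[OF Q v] by auto
  qed
  have ss: "semisimple (cmat N)"
    unfolding semisimple_def
  proof (intro allI ballI impI)
    fix \<mu> u w
    assume "u \<in> carrier_vec (dim_row (cmat N))" "w \<in> carrier_vec (dim_row (cmat N))"
      and Nu: "cmat N *\<^sub>v u = \<mu> \<cdot>\<^sub>v u + w" and Nw: "cmat N *\<^sub>v w = \<mu> \<cdot>\<^sub>v w"
    then have u: "u \<in> carrier_vec n" and w: "w \<in> carrier_vec n" using N by auto
    show "w = 0\<^sub>v (dim_row (cmat N))"
    proof (rule ccontr)
      assume "w \<noteq> 0\<^sub>v (dim_row (cmat N))"
      then have w0: "w \<noteq> 0\<^sub>v n" using N by simp
      then have "\<mu> = 0" using eig0 w Nw by blast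
      then have Nu: "cmat N *\<^sub>v u = w" and Nw: "cmat N *\<^sub>v w = 0\<^sub>v n"
        using Nu Nw u w by (auto intro!: eq_vecI)
      have "(cmat S *\<^sub>v w) \<bullet>c w = (cmat D *\<^sub>v u) \<bullet>c w" using Dv[OF u] Nu by simp
      also have "\<dots> = u \<bullet>c (cmat D *\<^sub>v w)" using cmat_adjoint[OF D(1) u w] D(2) by simp
      also have "cmat D *\<^sub>v w = 0\<^sub>v n" using Dv[OF w] Nw S(1) by (auto intro!: eq_vecI)
      finally show False using spd_complex_form[OF \<open>S \<in> spd n\<close> w w0] u by simp
    qed
  qed
  have "cmat N = cmat (0\<^sub>m n n)"
  proof (rule semisimple_mat_eqI[OF _ ss])
    fix u \<mu> assume u: "u \<in> carrier_vec n" "u \<noteq> 0\<^sub>v n" "cmat N *\<^sub>v u = \<mu> \<cdot>\<^sub>v u"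
    then have "\<mu> = 0" using eig0 by blast
    then show "cmat N *\<^sub>v u = cmat (0\<^sub>m n n) *\<^sub>v u" using u by (auto intro!: eq_vecI simp: scalar_prod_def)
  qed (use N in auto)
  then have "N = 0\<^sub>m n n" by (rule of_real_hom.mat_hom_inj)
  then show ?thesis using SN S(1) by simp
qed

text \<open>If \<open>X * X = Y * Y\<close>, then \<open>(X + Y) (X - Y) + (X - Y) (X + Y) = 0\<close>, a Lyapunov equation for \<open>X - Y\<close>
  with \<open>M = X + Y\<close> and \<open>S = 1\<close>.\<close>
lemma spd_sqrt_unique:
  assumes "X \<in> spd n" "Y \<in> spd n" "X * X = Y * Y"
  shows "X = Y"
proof -
  note X = spdD(1,2)[OF assms(1)] and Y = spdD(1,2)[OF assms(2)]
  have MT: "(X + Y)\<^sup>T = X + Y" using X Y by (simp add: transpose_add[of _ n n])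
  have "X - Y = 0\<^sub>m n n"
  proof (rule lyapunov_unique[OF _ _ _ spd_one])
    show "X + Y \<in> carrier_mat n n" "X - Y \<in> carrier_mat n n" "(X - Y)\<^sup>T = X - Y"
      using X Y by (auto simp: transpose_minus[of _ n n] intro: minus_carrier_mat)
    show "(X + Y) * 1\<^sub>m n + 1\<^sub>m n * (X + Y)\<^sup>T \<in> spd n"
      using X Y assms(1,2) by (simp add: MT spd_add)
    have c: "X * X \<in> carrier_mat n n" "X * Y \<in> carrier_mat n n" "Y * X \<in> carrier_mat n n" "Y * Y \<in> carrier_mat n n"
      using X Y by auto
    show "(X + Y) * (X - Y) + (X - Y) * (X + Y)\<^sup>T = 0\<^sub>m n n"
      unfolding MT using X(1) Y(1) c assms(3)
      by (simp add: add_mult_distrib_mat[of _ n n _ _ n] minus_mult_distrib_mat[of _ n n _ _ n]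
          mult_minus_distrib_mat[of _ n n _ n] mult_add_distrib_mat[of _ n n _ n] minus_carrier_mat)
        (auto intro!: eq_matI)
  qed
  then show ?thesis using X Y by (auto simp: mat_eq_iff)
qed

lemma spd_sqrt_eqI:
  assumes "X \<in> spd n" "X * X = S"
  shows "spd_sqrt S = X"
proof -
  have "dim_row S = n" using spdD(1)[OF assms(1)] assms(2) by auto
  then show ?thesis unfolding spd_sqrt_def using assms spd_sqrt_unique by (intro the_equality) auto
qed

lemma inv_sqrt_props:
  assumes "S \<in> spd n"
  obtains X where "X \<in> spd n" "X * X = S" "inv_sqrt S \<in> spd n" "inv_sqrt S * X = 1\<^sub>m n" "X * inv_sqrt S = 1\<^sub>m n"
proof -
  obtain X where X: "X \<in> spd n" "X * X = S" using spd_sqrt_exists[OF assms] by blast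
  obtain W where W: "mat_inverse X = Some W" "W \<in> carrier_mat n n" "X * W = 1\<^sub>m n" "W * X = 1\<^sub>m n"
    using spd_invertible[OF X(1)] .
  have "inv_sqrt S = W" unfolding inv_sqrt_def spd_sqrt_eqI[OF X] W(1) by simp
  then show ?thesis using that X W spd_inverse[OF X(1) W(2,4,3)] by blast
qed

lemma inv_sqrt_square:
  assumes "X \<in> spd n" "Y \<in> carrier_mat n n" "Y * X = 1\<^sub>m n"
  shows "inv_sqrt (X * X) = Y"
proof -
  note X = spdD(1)[OF assms(1)]
  obtain W where W: "mat_inverse X = Some W" "W \<in> carrier_mat n n" "X * W = 1\<^sub>m n" "W * X = 1\<^sub>m n"
    using spd_invertible[OF assms(1)] .
  have "Y = Y * (X * W)" using assms W by simp
  also have "\<dots> = (Y * X) * W" using X W(2) assms(2) by (intro assoc_mult_mat[symmetric])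
  also have "\<dots> = W" using assms(3) W(2) by simp
  finally show ?thesis unfolding inv_sqrt_def spd_sqrt_eqI[OF assms(1) refl] W(1) by simp
qed

lemma inv_sqrt_one: "inv_sqrt (1\<^sub>m n) = 1\<^sub>m n"
  using inv_sqrt_square[OF spd_one, of "1\<^sub>m n" n] by simp

section \<open>The matrix exponential\<close>

lemma pow_mat_Suc_left:
  assumes "A \<in> carrier_mat n n"
  shows "A * A ^\<^sub>m k = A ^\<^sub>m k * (A :: real mat)"
proof (induction k)
  case (Suc k)
  have "A * (A ^\<^sub>m k * A) = (A * A ^\<^sub>m k) * A"
    using assms by (intro assoc_mult_mat[symmetric]) auto
  then show ?case using Suc by simp
qed (use assms in simp)

lemma pow_mat_transpose:
  assumes "A \<in> carrier_mat n n"
  shows "(A ^\<^sub>m k)\<^sup>T = (A\<^sup>T ^\<^sub>m k :: real mat)"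
proof (induction k)
  case (Suc k)
  have "(A ^\<^sub>m Suc k)\<^sup>T = A\<^sup>T * (A ^\<^sub>m k)\<^sup>T"
    using assms by (simp add: transpose_mult[of _ n n _ n])
  then show ?case using Suc assms pow_mat_Suc_left[of "A\<^sup>T" n k] by simp
qed (use assms in simp)

lemma exp_m_carrier: "A \<in> carrier_mat n n \<Longrightarrow> exp_m A \<in> carrier_mat n n"
  by (simp add: exp_m_def)

lemma exp_m_transpose:
  assumes "A \<in> carrier_mat n n"
  shows "(exp_m A)\<^sup>T = exp_m A\<^sup>T"
proof (rule eq_matI)
  fix i j assume "i < dim_row (exp_m A\<^sup>T)" "j < dim_col (exp_m A\<^sup>T)"
  then have ij: "i < n" "j < n" using assms by (auto simp: exp_m_def)
  have "(A ^\<^sub>m k) $$ (j, i) = (A\<^sup>T ^\<^sub>m k) $$ (i, j)" for k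
    using ij assms pow_carrier_mat[OF assms, of k] by (simp flip: pow_mat_transpose[OF assms])
  then show "(exp_m A)\<^sup>T $$ (i, j) = exp_m A\<^sup>T $$ (i, j)"
    using ij assms by (simp add: exp_m_def)
qed (use assms in \<open>auto simp: exp_m_def\<close>)

lemma pow_mat_entry_bound:
  fixes A :: "real mat"
  assumes A: "A \<in> carrier_mat n n" and ij: "i < n" "j < n"
  shows "\<bar>(A ^\<^sub>m k) $$ (i, j)\<bar> \<le> (\<Sum>l<n. \<Sum>j<n. \<bar>A $$ (l, j)\<bar>) ^ k"
  using ij
proof (induction k arbitrary: j)
  case 0
  then show ?case using A by simp
next
  case (Suc k)
  let ?c = "\<Sum>l<n. \<Sum>j<n. \<bar>A $$ (l, j)\<bar>"
  have c: "?c \<ge> 0" by (intro sum_nonneg) auto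
  have Ak: "A ^\<^sub>m k \<in> carrier_mat n n" using A by simp
  have "(A ^\<^sub>m Suc k) $$ (i, j) = (\<Sum>l<n. (A ^\<^sub>m k) $$ (i, l) * A $$ (l, j))"
    using A Ak Suc by (simp add: scalar_prod_def lessThan_atLeast0)
  also have "\<bar>\<dots>\<bar> \<le> (\<Sum>l<n. \<bar>(A ^\<^sub>m k) $$ (i, l)\<bar> * \<bar>A $$ (l, j)\<bar>)"
    by (rule order_trans[OF sum_abs]) (simp add: abs_mult)
  also have "\<dots> \<le> (\<Sum>l<n. ?c ^ k * (\<Sum>j<n. \<bar>A $$ (l, j)\<bar>))"
    using Suc c by (intro sum_mono mult_mono member_le_sum[of j _ "\<lambda>j. \<bar>A $$ (_, j)\<bar>"]) auto
  also have "\<dots> = ?c ^ Suc k" by (simp flip: sum_distrib_left)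
  finally show ?case .
qed

lemma exp_m_sums:
  assumes A: "A \<in> carrier_mat n n" and ij: "i < n" "j < n"
  shows "(\<lambda>k. (A ^\<^sub>m k) $$ (i, j) / fact k) sums (exp_m A $$ (i, j))"
proof -
  let ?c = "\<Sum>l<n. \<Sum>j<n. \<bar>A $$ (l, j)\<bar>"
  have "summable (\<lambda>k. (A ^\<^sub>m k) $$ (i, j) / fact k)"
  proof (rule summable_comparison_test')
    show "summable (\<lambda>k. inverse (fact k) * ?c ^ k)" by (rule summable_exp)
    show "norm ((A ^\<^sub>m k) $$ (i, j) / fact k) \<le> inverse (fact k) * ?c ^ k" for k
      using pow_mat_entry_bound[OF A ij, of k] by (simp add: divide_inverse abs_mult mult.commute mult_left_mono)
  qed
  then show ?thesis using A ij by (simp add: exp_m_def summable_sums)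
qed

lemma exp_m_mult_vec_sums:
  assumes A: "A \<in> carrier_mat n n" and u: "u \<in> carrier_vec n" and i: "i < n"
  shows "(\<lambda>k. (cmat (A ^\<^sub>m k) *\<^sub>v u) $ i / fact k) sums ((cmat (exp_m A) *\<^sub>v u) $ i)"
proof -
  have "(\<lambda>k. \<Sum>j<n. of_real ((A ^\<^sub>m k) $$ (i, j) / fact k) * u $ j) sums
      (\<Sum>j<n. of_real (exp_m A $$ (i, j)) * u $ j)"
    using exp_m_sums[OF A i] by (intro sums_sum sums_mult2) (simp only: sums_of_real_iff lessThan_iff)
  moreover have "(cmat B *\<^sub>v u) $ i = (\<Sum>j<n. of_real (B $$ (i, j)) * u $ j)"
    if "B \<in> carrier_mat n n" for B
    using that u i by (simp add: scalar_prod_def lessThan_atLeast0)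
  ultimately show ?thesis
    using A exp_m_carrier[OF A] by (simp add: sum_divide_distrib)
qed

text \<open>Powers act on a Jordan chain by \<open>A\<^sup>k u = \<mu>\<^sup>k u + k \<mu>\<^sup>k\<^sup>-\<^sup>1 w\<close>. The term in \<open>w\<close> shows that a Jordan
  chain of \<open>A\<close> is, up to a scalar, also one of \<open>exp_m A\<close>.\<close>
lemma exp_m_chain:
  assumes A: "A \<in> carrier_mat n n" and u: "u \<in> carrier_vec n" and w: "w \<in> carrier_vec n"
    and Au: "cmat A *\<^sub>v u = \<mu> \<cdot>\<^sub>v u + w" and Aw: "cmat A *\<^sub>v w = \<mu> \<cdot>\<^sub>v w"
  shows "cmat (exp_m A) *\<^sub>v u = exp \<mu> \<cdot>\<^sub>v (u + w)"
proof -
  have Ak: "A ^\<^sub>m k \<in> carrier_mat n n" for k using A by simp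
  have kw: "cmat (A ^\<^sub>m k) *\<^sub>v w = \<mu> ^ k \<cdot>\<^sub>v w" for k
  proof (induction k)
    case (Suc k)
    then show ?case
      using cmat_mult_vec[OF Ak[of k] A w] Aw w Ak[of k]
      by (simp add: mult_mat_vec[of _ n n] smult_smult_assoc mult.commute)
  qed (use A w in \<open>simp add: of_real_hom.mat_hom_one\<close>)
  have ku: "cmat (A ^\<^sub>m k) *\<^sub>v u = \<mu> ^ k \<cdot>\<^sub>v u + (of_nat k * \<mu> ^ (k - 1)) \<cdot>\<^sub>v w" for k
  proof (induction k)
    case 0
    show ?case using A u w by (auto simp: of_real_hom.mat_hom_one)
  next
    case (Suc k)
    have "cmat (A ^\<^sub>m Suc k) *\<^sub>v u = \<mu> \<cdot>\<^sub>v (cmat (A ^\<^sub>m k) *\<^sub>v u) + cmat (A ^\<^sub>m k) *\<^sub>v w"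
      using cmat_mult_vec[OF Ak[of k] A u] Au u w Ak[of k]
      by (simp add: mult_mat_vec[of _ n n] mult_add_distrib_mat_vec[of _ n n])
    also have "\<dots> = \<mu> ^ Suc k \<cdot>\<^sub>v u + (of_nat (Suc k) * \<mu> ^ (Suc k - 1)) \<cdot>\<^sub>v w"
      unfolding Suc kw using u w by (cases k) (auto intro!: eq_vecI simp: algebra_simps)
    finally show ?case .
  qed
  show ?thesis
  proof (rule eq_vecI)
    fix i assume "i < dim_vec (exp \<mu> \<cdot>\<^sub>v (u + w))"
    then have i: "i < n" using w by simp
    have e: "(\<lambda>k. \<mu> ^ k / fact k) sums exp \<mu>"
      using exp_converges[of \<mu>] by (simp add: scaleR_conv_of_real divide_inverse mult.commute)
    have "(\<lambda>k. of_nat (Suc k) * \<mu> ^ (Suc k - 1) / fact (Suc k)) = (\<lambda>k. \<mu> ^ k / fact k)"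
      by (intro ext) (simp del: of_nat_Suc)
    then have "(\<lambda>k. of_nat k * \<mu> ^ (k - 1) / fact k) sums exp \<mu>"
      using e sums_Suc[of "\<lambda>k. of_nat k * \<mu> ^ (k - 1) / fact k" "exp \<mu>"] by simp
    from sums_add[OF sums_mult2[OF e, of "u $ i"] sums_mult2[OF this, of "w $ i"]]
    have "(\<lambda>k. (cmat (A ^\<^sub>m k) *\<^sub>v u) $ i / fact k) sums (exp \<mu> * (u $ i) + exp \<mu> * (w $ i))"
      unfolding ku using u w i by (simp add: add_divide_distrib)
    then have "(cmat (exp_m A) *\<^sub>v u) $ i = exp \<mu> * (u $ i) + exp \<mu> * (w $ i)"
      using exp_m_mult_vec_sums[OF A u i] by (rule sums_unique2[symmetric])
    then show "(cmat (exp_m A) *\<^sub>v u) $ i = (exp \<mu> \<cdot>\<^sub>v (u + w)) $ i"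
      using u w i by (simp add: algebra_simps)
  qed (use exp_m_carrier[OF A] w in auto)
qed

lemma exp_m_eigenvector:
  assumes A: "A \<in> carrier_mat n n" and u: "u \<in> carrier_vec n" and Au: "cmat A *\<^sub>v u = \<mu> \<cdot>\<^sub>v u"
  shows "cmat (exp_m A) *\<^sub>v u = exp \<mu> \<cdot>\<^sub>v u"
proof -
  have "cmat A *\<^sub>v 0\<^sub>v n = \<mu> \<cdot>\<^sub>v 0\<^sub>v n" using A by (auto intro!: eq_vecI)
  then show ?thesis using exp_m_chain[OF A u, of "0\<^sub>v n" \<mu>] Au u by simp
qed

lemma exp_m_add_multiples:
  assumes A: "A \<in> carrier_mat n n" "A\<^sup>T = \<sigma> \<cdot>\<^sub>m A"
  shows "exp_m (s \<cdot>\<^sub>m A) * exp_m (t \<cdot>\<^sub>m A) = exp_m ((s + t) \<cdot>\<^sub>m A)"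
proof (rule real_semisimple_mat_eqI[OF A])
  have c: "exp_m (r \<cdot>\<^sub>m A) \<in> carrier_mat n n" for r using A by (simp add: exp_m_carrier)
  then show "exp_m (s \<cdot>\<^sub>m A) * exp_m (t \<cdot>\<^sub>m A) \<in> carrier_mat n n" "exp_m ((s + t) \<cdot>\<^sub>m A) \<in> carrier_mat n n"
    by (auto intro!: mult_carrier_mat[of _ n n])
  fix u \<mu> assume u: "u \<in> carrier_vec n" "cmat A *\<^sub>v u = \<mu> \<cdot>\<^sub>v u"
  have "cmat (exp_m (r \<cdot>\<^sub>m A)) *\<^sub>v u = exp (of_real r * \<mu>) \<cdot>\<^sub>v u" for r
    using A u by (intro exp_m_eigenvector[of _ n]) (auto simp: cmat_smult_vec[of _ n n] smult_smult_assoc)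
  then show "cmat (exp_m (s \<cdot>\<^sub>m A) * exp_m (t \<cdot>\<^sub>m A)) *\<^sub>v u = cmat (exp_m ((s + t) \<cdot>\<^sub>m A)) *\<^sub>v u"
    using c u by (simp add: cmat_mult_vec[of _ n n _ n] mult_mat_vec[of _ n n] smult_smult_assoc
        distrib_right add.commute flip: exp_add)
qed

lemma exp_m_zero: "exp_m (0\<^sub>m n n) = 1\<^sub>m n"
proof (rule real_semisimple_mat_eqI[of "0\<^sub>m n n" n 1])
  fix u :: "complex vec" assume u: "u \<in> carrier_vec n"
  have "cmat (0\<^sub>m n n) *\<^sub>v u = 0 \<cdot>\<^sub>v u" using u by (auto intro!: eq_vecI simp: scalar_prod_def)
  then have "cmat (exp_m (0\<^sub>m n n)) *\<^sub>v u = exp 0 \<cdot>\<^sub>v u"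
    using u by (intro exp_m_eigenvector) auto
  then show "cmat (exp_m (0\<^sub>m n n)) *\<^sub>v u = cmat (1\<^sub>m n) *\<^sub>v u"
    using u by (simp add: of_real_hom.mat_hom_one)
qed (auto simp: exp_m_carrier)

lemma skewD:
  assumes "A \<in> skew n"
  shows "A \<in> carrier_mat n n" "A\<^sup>T = (-1) \<cdot>\<^sub>m A"
proof -
  show A: "A \<in> carrier_mat n n" using assms by (simp add: skew_def)
  have "A\<^sup>T = - A" using assms by (simp add: skew_def)
  also have "\<dots> = (-1) \<cdot>\<^sub>m A" by (intro eq_matI) auto
  finally show "A\<^sup>T = (-1) \<cdot>\<^sub>m A" .
qed

lemma skewI: "A \<in> carrier_mat n n \<Longrightarrow> A\<^sup>T = (-1) \<cdot>\<^sub>m A \<Longrightarrow> A \<in> skew n"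
  unfolding skew_def by (auto intro!: eq_matI)

lemma exp_m_skew_orthogonal:
  assumes "A \<in> skew n"
  shows "(exp_m A)\<^sup>T * exp_m A = 1\<^sub>m n"
proof -
  note A = skewD[OF assms]
  have 1: "1 \<cdot>\<^sub>m A = A" and 0: "(-1 + 1) \<cdot>\<^sub>m A = 0\<^sub>m n n" using A(1) by (auto intro!: eq_matI)
  have "(exp_m A)\<^sup>T * exp_m A = exp_m ((-1) \<cdot>\<^sub>m A) * exp_m (1 \<cdot>\<^sub>m A)"
    using exp_m_transpose[OF A(1)] A(2) 1 by simp
  also have "\<dots> = 1\<^sub>m n" unfolding exp_m_add_multiples[OF A] 0 exp_m_zero ..
  finally show ?thesis .
qed

section \<open>The principal logarithm of an orthogonal matrix\<close>

lemma orthogonal_isometry: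
  assumes "E \<in> carrier_mat n n" "E\<^sup>T * E = 1\<^sub>m n" "u \<in> carrier_vec n" "v \<in> carrier_vec n"
  shows "(cmat E *\<^sub>v u) \<bullet>c (cmat E *\<^sub>v v) = u \<bullet>c v"
proof -
  have "(cmat E *\<^sub>v u) \<bullet>c (cmat E *\<^sub>v v) = u \<bullet>c (cmat (E\<^sup>T * E) *\<^sub>v v)"
    using cmat_adjoint[OF assms(1,3), of "cmat E *\<^sub>v v"] cmat_mult_vec[of "E\<^sup>T" n n E n v] assms(1,4)
    by simp
  then show ?thesis using assms by (simp add: of_real_hom.mat_hom_one)
qed

text \<open>Preservation of \<open>\<langle>w, w\<rangle>\<close> gives \<open>\<bar>\<mu>\<bar> = 1\<close> for a Jordan chain \<open>E u = \<mu> u + w\<close>, \<open>E w = \<mu> w\<close>, and then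
  preservation of \<open>\<langle>u, w\<rangle>\<close> leaves no room for the term \<open>\<langle>w, w\<rangle>\<close>.\<close>
lemma semisimple_orthogonal:
  assumes E: "E \<in> carrier_mat n n" "E\<^sup>T * E = 1\<^sub>m n"
  shows "semisimple (cmat E)"
  unfolding semisimple_def
proof (intro allI ballI impI)
  fix \<mu> u w
  assume "u \<in> carrier_vec (dim_row (cmat E))" "w \<in> carrier_vec (dim_row (cmat E))"
    and Eu: "cmat E *\<^sub>v u = \<mu> \<cdot>\<^sub>v u + w" and Ew: "cmat E *\<^sub>v w = \<mu> \<cdot>\<^sub>v w"
  then have u: "u \<in> carrier_vec n" and w: "w \<in> carrier_vec n" using E by auto
  show "w = 0\<^sub>v (dim_row (cmat E))"
  proof (rule ccontr)
    assume "w \<noteq> 0\<^sub>v (dim_row (cmat E))"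
    then have "w \<noteq> 0\<^sub>v n" using E by simp
    then have w0: "w \<bullet>c w \<noteq> 0" using conjugate_square_eq_0_vec[OF w] by simp
    have "w \<bullet>c w = \<mu> * cnj \<mu> * (w \<bullet>c w)"
      using orthogonal_isometry[OF E w w] w unfolding Ew by (simp add: sesquilinear_simps[of _ n] ac_simps)
    then have 1: "\<mu> * cnj \<mu> = 1" using w0 by simp
    have "u \<bullet>c w = \<mu> * cnj \<mu> * (u \<bullet>c w) + cnj \<mu> * (w \<bullet>c w)"
      using orthogonal_isometry[OF E u w] u w unfolding Eu Ew
      by (simp add: sesquilinear_simps[of _ n] algebra_simps)
    then have "cnj \<mu> * (w \<bullet>c w) = 0" unfolding 1 by simp
    then show False using w0 1 by simp
  qed
qed

lemma strip_eigenvector: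
  assumes "in_principal_strip A" "A \<in> carrier_mat n n" "v \<in> carrier_vec n" "v \<noteq> 0\<^sub>v n" "cmat A *\<^sub>v v = \<mu> \<cdot>\<^sub>v v"
  shows "\<bar>Im \<mu>\<bar> < pi"
  using assms unfolding in_principal_strip_def eigenvalue_def eigenvector_def by auto

text \<open>The competitor \<open>X\<close> is an arbitrary real matrix, so its diagonalizability has to be derived first:
  a Jordan chain of \<open>X\<close> would give one of the orthogonal matrix \<open>E = exp_m X\<close>. It remains to see that an
  eigenvector \<open>u\<close> of \<open>X\<close>, say to \<open>\<mu>\<close>, is one of \<open>A\<close>. As \<open>exp\<close> is injective on the strip, \<open>E - exp \<mu>\<close> acts
  by nonzero scalars on the eigenvectors of \<open>A\<close> to other eigenvalues, so \<open>u = w + (E - exp \<mu>) x\<close> with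
  \<open>A w = \<mu> w\<close>. Now \<open>E - exp \<mu>\<close> annihilates \<open>u\<close> and \<open>w\<close>, and therefore \<open>(E - exp \<mu>) x\<close>, which then vanishes
  because \<open>E\<close> has no Jordan chains.\<close>
lemma principal_log_unique:
  assumes "A \<in> skew n" and As: "in_principal_strip A"
    and X: "X \<in> carrier_mat n n" and Xs: "in_principal_strip X" and eq: "exp_m X = exp_m A"
  shows "X = A"
proof -
  note A = skewD[OF assms(1)]
  define E where "E = exp_m A"
  have E: "E \<in> carrier_mat n n" "E\<^sup>T * E = 1\<^sub>m n"
    using exp_m_carrier[OF A(1)] exp_m_skew_orthogonal[OF assms(1)] by (auto simp: E_def)
  note ssE = semisimple_orthogonal[OF E]
  have ssX: "semisimple (cmat X)"
    unfolding semisimple_def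
  proof (intro allI ballI impI)
    fix \<mu> u w
    assume "u \<in> carrier_vec (dim_row (cmat X))" "w \<in> carrier_vec (dim_row (cmat X))"
      and Xu: "cmat X *\<^sub>v u = \<mu> \<cdot>\<^sub>v u + w" and Xw: "cmat X *\<^sub>v w = \<mu> \<cdot>\<^sub>v w"
    then have u: "u \<in> carrier_vec n" and w: "w \<in> carrier_vec n" using X by auto
    have "cmat E *\<^sub>v w = exp \<mu> \<cdot>\<^sub>v w"
      using exp_m_eigenvector[OF X w Xw] by (simp add: E_def eq)
    then have "cmat E *\<^sub>v (exp \<mu> \<cdot>\<^sub>v w) = exp \<mu> \<cdot>\<^sub>v (exp \<mu> \<cdot>\<^sub>v w)"
      using E w by (simp add: mult_mat_vec[of _ n n])
    moreover have "cmat E *\<^sub>v u = exp \<mu> \<cdot>\<^sub>v u + exp \<mu> \<cdot>\<^sub>v w"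
      using exp_m_chain[OF X u w Xu Xw] u w by (simp add: E_def eq smult_add_distrib_vec[of _ n])
    ultimately have "exp \<mu> \<cdot>\<^sub>v w = 0\<^sub>v n"
      using E u w by (intro semisimpleD[OF ssE, of n u _ "exp \<mu>"]) auto
    then have "exp (-\<mu>) \<cdot>\<^sub>v (exp \<mu> \<cdot>\<^sub>v w) = 0\<^sub>v n" by (auto intro!: eq_vecI)
    then show "w = 0\<^sub>v (dim_row (cmat X))" using X by (simp add: smult_smult_assoc flip: exp_add)
  qed
  have "cmat X = cmat A"
  proof (rule semisimple_mat_eqI[OF _ ssX])
    fix u \<mu> assume u: "u \<in> carrier_vec n" "u \<noteq> 0\<^sub>v n" "cmat X *\<^sub>v u = \<mu> \<cdot>\<^sub>v u"
    have \<mu>: "\<bar>Im \<mu>\<bar> < pi" using strip_eigenvector[OF Xs X u] .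
    have Eu: "cmat E *\<^sub>v u = exp \<mu> \<cdot>\<^sub>v u"
      using exp_m_eigenvector[OF X u(1,3)] by (simp add: E_def eq)
    define F where "F = cmat E - exp \<mu> \<cdot>\<^sub>m 1\<^sub>m n"
    have Fv: "F *\<^sub>v v = cmat E *\<^sub>v v - exp \<mu> \<cdot>\<^sub>v v" if "v \<in> carrier_vec n" for v
      using E that by (auto simp: F_def minus_mult_distrib_mat_vec[of _ n n])
    have F: "F \<in> carrier_mat n n" unfolding F_def by (intro minus_carrier_mat) simp
    have "\<exists>w \<in> carrier_vec n. \<exists>x \<in> eigsum (cmat A). cmat A *\<^sub>v w = \<mu> \<cdot>\<^sub>v w \<and> u = w + F *\<^sub>v x"
    proof (rule eigsum_peel[OF _ F])
      show "u \<in> eigsum (cmat A)"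
        using A(1) u(1) by (intro semisimple_eigsum[OF _ semisimple_sym_skew[OF A]]) auto
      fix v \<nu> assume v: "v \<in> carrier_vec n" "v \<noteq> 0\<^sub>v n" "cmat A *\<^sub>v v = \<nu> \<cdot>\<^sub>v v" "\<nu> \<noteq> \<mu>"
      have "\<bar>Im \<nu>\<bar> < pi" using strip_eigenvector[OF As A(1) v(1-3)] .
      then have "\<bar>Im \<nu> - Im \<mu>\<bar> < 2 * pi" using \<mu> by linarith
      then have "exp \<nu> \<noteq> exp \<mu>" using exp_complex_eqI v(4) by blast
      moreover have "cmat E *\<^sub>v v = exp \<nu> \<cdot>\<^sub>v v" using exp_m_eigenvector[OF A(1) v(1,3)] by (simp add: E_def)
      ultimately show "\<exists>c. c \<noteq> 0 \<and> F *\<^sub>v v = c \<cdot>\<^sub>v v"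
        using v by (intro exI[of _ "exp \<nu> - exp \<mu>"]) (auto simp: Fv left_diff_distrib intro!: eq_vecI)
    qed (use A in simp)
    then obtain w x where w: "w \<in> carrier_vec n" "cmat A *\<^sub>v w = \<mu> \<cdot>\<^sub>v w"
      and x: "x \<in> eigsum (cmat A)" and uw: "u = w + F *\<^sub>v x" by blast
    have xc: "x \<in> carrier_vec n" using eigsum_carrier[OF x] A by simp
    have Fx: "F *\<^sub>v x \<in> carrier_vec n" using F xc by simp
    have Ew: "cmat E *\<^sub>v w = exp \<mu> \<cdot>\<^sub>v w" using exp_m_eigenvector[OF A(1) w] by (simp add: E_def)
    have Fxe: "F *\<^sub>v x = u - w" unfolding uw using w(1) F xc by (intro eq_vecI) auto
    have "cmat E *\<^sub>v (F *\<^sub>v x) = exp \<mu> \<cdot>\<^sub>v (F *\<^sub>v x)"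
      unfolding Fxe using E(1) u(1) w(1) Eu Ew
      by (simp add: mult_minus_distrib_mat_vec[of _ n n]) (auto intro!: eq_vecI simp: algebra_simps)
    moreover have "cmat E *\<^sub>v x = exp \<mu> \<cdot>\<^sub>v x + F *\<^sub>v x"
      using E(1) xc by (simp add: Fv) (auto intro!: eq_vecI)
    ultimately have "F *\<^sub>v x = 0\<^sub>v n"
      using E xc Fx by (intro semisimpleD[OF ssE, of n x _ "exp \<mu>"]) auto
    then have "u = w" using uw w by simp
    then show "cmat X *\<^sub>v u = cmat A *\<^sub>v u" using u w by simp
  qed (use X A in auto)
  then show ?thesis by (rule of_real_hom.mat_hom_inj)
qed

lemma log_m_exp_m:
  assumes "A \<in> skew n" "in_principal_strip A"
  shows "log_m (exp_m A) = A"
proof -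
  note A = skewD(1)[OF assms(1)]
  have "dim_row (exp_m A) = n" using exp_m_carrier[OF A] by simp
  then show ?thesis
    unfolding log_m_def using A assms principal_log_unique[OF assms] by (intro the_equality) auto
qed

lemma zero_skew: "0\<^sub>m n n \<in> skew n"
  by (intro skewI) (auto intro!: eq_matI)

lemma in_principal_strip_zero: "in_principal_strip (0\<^sub>m n n)"
  unfolding in_principal_strip_def
proof (intro allI impI)
  fix z assume "eigenvalue (cmat (0\<^sub>m n n)) z"
  then obtain v where v: "v \<in> carrier_vec n" "v \<noteq> 0\<^sub>v n" "cmat (0\<^sub>m n n) *\<^sub>v v = z \<cdot>\<^sub>v v"
    by (auto simp: eigenvalue_def eigenvector_def)
  have "z = 1 * cnj z" "z = -1 * cnj z"
    using eigenvalue_sym_skew[of "0\<^sub>m n n" n 1 v z] eigenvalue_sym_skew[OF skewD[OF zero_skew] v] v by auto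
  then have "z = 0" by (auto simp: complex_eq_iff)
  then show "\<bar>Im z\<bar> < pi" by simp
qed

lemma log_m_one: "log_m (1\<^sub>m n) = 0\<^sub>m n n"
  using log_m_exp_m[OF zero_skew in_principal_strip_zero] by (simp add: exp_m_zero)

text \<open>An eigenvalue outside the strip is \<open>\<i> \<theta>\<close> with \<open>\<bar>\<theta>\<bar> \<ge> \<pi>\<close>, and \<open>B = t A\<close> with \<open>t = \<pi> / \<bar>\<theta>\<bar>\<close> has the
  eigenvalue \<open>\<plusminus>\<i> \<pi>\<close>. Reversing the rotation in the planes of angle \<open>\<pi>\<close> changes neither the exponential,
  as \<open>exp(\<i> \<pi>) = exp(-\<i> \<pi>)\<close>, nor the square, and hence not the norm. The reversal is multiplication by
  \<open>F = f(B\<^sup>2)\<close>, where \<open>f\<close> is \<open>-1\<close> at \<open>-\<pi>\<^sup>2\<close> and \<open>1\<close> elsewhere; a function of the square is used so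
  that \<open>F\<close> is symmetric and \<open>A' = B F\<close> is again skew-symmetric.\<close>
lemma exp_m_not_injective_outside_strip:
  assumes "A \<in> skew n" and ns: "\<not> in_principal_strip A"
  obtains t A' where "0 \<le> t" "t \<le> 1" "A' \<in> skew n" "A' \<noteq> t \<cdot>\<^sub>m A" "A' * A' = (t \<cdot>\<^sub>m A) * (t \<cdot>\<^sub>m A)"
    "exp_m A' = exp_m (t \<cdot>\<^sub>m A)"
proof -
  note A = skewD[OF assms(1)]
  obtain z v where z: "\<bar>Im z\<bar> \<ge> pi" and v: "v \<in> carrier_vec n" "v \<noteq> 0\<^sub>v n" "cmat A *\<^sub>v v = z \<cdot>\<^sub>v v"
    using ns A(1) unfolding in_principal_strip_def eigenvalue_def eigenvector_def by (auto simp: not_less)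
  have "z = - cnj z" using eigenvalue_sym_skew[OF A v] by simp
  then have "Re z = 0" by (simp add: complex_eq_iff)
  define t where "t = pi / \<bar>Im z\<bar>"
  have "\<bar>Im z\<bar> > 0" using z pi_gt_zero by linarith
  then have t: "0 \<le> t" "t \<le> 1" using z by (simp_all add: t_def)
  define B where "B = t \<cdot>\<^sub>m A"
  have "B\<^sup>T = t \<cdot>\<^sub>m A\<^sup>T" unfolding B_def by (intro eq_matI) auto
  also have "\<dots> = (-1) \<cdot>\<^sub>m B" unfolding A(2) B_def by (intro eq_matI) auto
  finally have B: "B \<in> carrier_mat n n" "B\<^sup>T = (-1) \<cdot>\<^sub>m B" using A(1) by (auto simp: B_def)
  have Bv: "cmat B *\<^sub>v v = (of_real t * z) \<cdot>\<^sub>v v"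
    using A v by (simp add: B_def cmat_smult_vec[of _ n n] smult_smult_assoc)
  have tz2: "(of_real t * z)\<^sup>2 = of_real (- (pi\<^sup>2))"
  proof -
    have "z * z = of_real (- (Im z * Im z))" using \<open>Re z = 0\<close> by (simp add: complex_eq_iff)
    moreover have "(of_real t * z)\<^sup>2 = of_real t * of_real t * (z * z)"
      by (simp add: power2_eq_square mult.assoc mult.left_commute)
    ultimately have "(of_real t * z)\<^sup>2 = of_real (- ((t * Im z)\<^sup>2))" by (simp add: power2_eq_square)
    also have "(t * Im z)\<^sup>2 = pi\<^sup>2" using \<open>\<bar>Im z\<bar> > 0\<close>
      by (simp add: t_def power_divide power_mult_distrib)
    finally show ?thesis .
  qed
  define S where "S = B * B"
  have "S\<^sup>T = B\<^sup>T * B\<^sup>T" unfolding S_def using B(1) by (intro transpose_mult[of _ n n _ n])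
  also have "\<dots> = S" unfolding B(2) S_def using B(1) by (simp add: mult_smult_distrib[of _ n n _ n]
        mult_smult_assoc_mat[of _ n n _ n]) (auto intro!: eq_matI)
  finally have S: "S \<in> carrier_mat n n" "S\<^sup>T = S" using B(1) by (auto simp: S_def)
  define f :: "real \<Rightarrow> real" where "f r = (if r = - (pi\<^sup>2) then -1 else 1)" for r
  obtain F where F: "F \<in> carrier_mat n n" "F\<^sup>T = F"
    and Fu: "\<And>u r. u \<in> carrier_vec n \<Longrightarrow> cmat S *\<^sub>v u = of_real r \<cdot>\<^sub>v u \<Longrightarrow> cmat F *\<^sub>v u = of_real (f r) \<cdot>\<^sub>v u"
    by (rule symmetric_function[OF S, of f]) blast
  have eig: "\<exists>r. \<mu>\<^sup>2 = of_real r \<and> cmat F *\<^sub>v u = of_real (f r) \<cdot>\<^sub>v u"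
    if u: "u \<in> carrier_vec n" "u \<noteq> 0\<^sub>v n" "cmat B *\<^sub>v u = \<mu> \<cdot>\<^sub>v u" for u \<mu>
  proof -
    have Su: "cmat S *\<^sub>v u = \<mu>\<^sup>2 \<cdot>\<^sub>v u"
      using B(1) u by (simp add: S_def cmat_mult_vec[of _ n n _ n] mult_mat_vec[of _ n n] smult_smult_assoc
          power2_eq_square)
    obtain r where "\<mu>\<^sup>2 = of_real r" using eigenvalue_sym_real[OF S u(1,2) Su] .
    then show ?thesis using Fu[OF u(1)] Su by auto
  qed
  define A' where "A' = B * F"
  have A'c: "A' \<in> carrier_mat n n" using B F by (simp add: A'_def)
  have A'u: "cmat A' *\<^sub>v u = (of_real (f r) * \<mu>) \<cdot>\<^sub>v u"
    if "u \<in> carrier_vec n" "cmat B *\<^sub>v u = \<mu> \<cdot>\<^sub>v u" "cmat F *\<^sub>v u = of_real (f r) \<cdot>\<^sub>v u" for u \<mu> r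
    using that B(1) F(1) by (simp add: A'_def cmat_mult_vec[of _ n n _ n] mult_mat_vec[of _ n n] smult_smult_assoc)
  have comm: "B * F = F * B"
  proof (rule real_semisimple_mat_eqI[OF B])
    fix u \<mu> assume u: "u \<in> carrier_vec n" "u \<noteq> 0\<^sub>v n" "cmat B *\<^sub>v u = \<mu> \<cdot>\<^sub>v u"
    then obtain r where "cmat F *\<^sub>v u = of_real (f r) \<cdot>\<^sub>v u" using eig by blast
    then show "cmat (B * F) *\<^sub>v u = cmat (F * B) *\<^sub>v u"
      using u B(1) F(1) by (simp add: cmat_mult_vec[of _ n n _ n] mult_mat_vec[of _ n n] smult_smult_assoc mult.commute)
  qed (use B F in auto)
  have "A'\<^sup>T = F\<^sup>T * B\<^sup>T" unfolding A'_def using B(1) F(1) by (rule transpose_mult)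
  also have "\<dots> = (-1) \<cdot>\<^sub>m A'" unfolding F(2) B(2) A'_def comm using B(1) F(1) by (rule mult_smult_distrib[rotated])
  finally have A': "A' \<in> skew n" using A'c by (intro skewI)
  have sq: "A' * A' = B * B"
  proof (rule real_semisimple_mat_eqI[OF B])
    fix u \<mu> assume u: "u \<in> carrier_vec n" "u \<noteq> 0\<^sub>v n" "cmat B *\<^sub>v u = \<mu> \<cdot>\<^sub>v u"
    then obtain r where r: "cmat F *\<^sub>v u = of_real (f r) \<cdot>\<^sub>v u" using eig by blast
    have ff: "of_real (f r) * \<mu> * (of_real (f r) * \<mu>) = \<mu> * \<mu>" by (simp add: f_def)
    have "cmat (A' * A') *\<^sub>v u = (of_real (f r) * \<mu> * (of_real (f r) * \<mu>)) \<cdot>\<^sub>v u"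
      using A'u[OF u(1,3) r] u A'c
      by (simp add: cmat_mult_vec[of _ n n _ n] mult_mat_vec[of _ n n] smult_smult_assoc)
    then show "cmat (A' * A') *\<^sub>v u = cmat (B * B) *\<^sub>v u"
      unfolding ff using u B(1)
      by (simp add: cmat_mult_vec[of _ n n _ n] mult_mat_vec[of _ n n] smult_smult_assoc)
  qed (use A'c B in auto)
  have ex: "exp_m A' = exp_m B"
  proof (rule real_semisimple_mat_eqI[OF B])
    fix u \<mu> assume u: "u \<in> carrier_vec n" "u \<noteq> 0\<^sub>v n" "cmat B *\<^sub>v u = \<mu> \<cdot>\<^sub>v u"
    then obtain r where r: "\<mu>\<^sup>2 = of_real r" "cmat F *\<^sub>v u = of_real (f r) \<cdot>\<^sub>v u" using eig by blast
    have "exp (of_real (f r) * \<mu>) = exp \<mu>"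
    proof (cases "r = - (pi\<^sup>2)")
      case True
      then have "\<mu>\<^sup>2 = (\<i> * of_real pi)\<^sup>2" using r by (simp add: power_mult_distrib)
      then have "\<mu> = \<i> * of_real pi \<or> \<mu> = - (\<i> * of_real pi)" by (simp add: power2_eq_iff)
      then show ?thesis using True exp_minus[of "\<i> * of_real pi"] by (auto simp: f_def exp_pi_i')
    qed (simp add: f_def)
    then show "cmat (exp_m A') *\<^sub>v u = cmat (exp_m B) *\<^sub>v u"
      using exp_m_eigenvector[OF A'c u(1) A'u[OF u(1,3) r(2)]] exp_m_eigenvector[OF B(1) u(1,3)] by simp
  qed (use A'c B exp_m_carrier in auto)
  have "A' \<noteq> B"
  proof
    assume eq: "A' = B"
    obtain r where r: "(of_real t * z)\<^sup>2 = of_real r" "cmat F *\<^sub>v v = of_real (f r) \<cdot>\<^sub>v v"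
      using eig[OF v(1,2) Bv] by blast
    have "r = - (pi\<^sup>2)" using r(1) unfolding tz2 by (metis of_real_eq_iff)
    then have "cmat B *\<^sub>v v = (- (of_real t * z)) \<cdot>\<^sub>v v" using A'u[OF v(1) Bv r(2)] eq by (simp add: f_def)
    then have "(of_real t * z) \<cdot>\<^sub>v v = (- (of_real t * z)) \<cdot>\<^sub>v v" using Bv by simp
    then have "of_real t * z = 0 \<or> v = 0\<^sub>v n" using v(1) by (auto simp: vec_eq_iff)
    then show False using v(2) tz2 by (auto simp: power2_eq_square)
  qed
  then show ?thesis using that[OF t A'] sq ex by (simp add: B_def)
qed

section \<open>Block matrices\<close>

lemma add_diff_cancel_mat:
  fixes X :: "'a::ab_group_add mat"
  shows "X \<in> carrier_mat n m \<Longrightarrow> Y \<in> carrier_mat n m \<Longrightarrow> X + Y - X = Y"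
  by (intro eq_matI) auto

lemma diff_add_diff_mat:
  fixes X :: "'a::ab_group_add mat"
  assumes "X \<in> carrier_mat n m" "X' \<in> carrier_mat n m" "Y \<in> carrier_mat n m" "Y' \<in> carrier_mat n m"
  shows "(X - X') + (Y - Y') = (X + Y) - (X' + Y')"
  using assms by (intro eq_matI) auto

lemma hcat_carrier: "X \<in> carrier_mat n p \<Longrightarrow> Y \<in> carrier_mat n q \<Longrightarrow> hcat X Y \<in> carrier_mat n (p + q)"
  by (auto simp: hcat_def)

lemma hcat_mult_append_rows:
  assumes "X \<in> carrier_mat n p" "Y \<in> carrier_mat n q" "C \<in> carrier_mat p m" "D \<in> carrier_mat q m"
  shows "hcat X Y * (C @\<^sub>r D) = X * C + Y * D"
proof -
  have "hcat X Y * (C @\<^sub>r D) = four_block_mat (X * C + Y * D) (X * 0\<^sub>m p 0 + Y * 0\<^sub>m q 0)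
      (0\<^sub>m 0 p * C + 0\<^sub>m 0 q * D) (0\<^sub>m 0 p * 0\<^sub>m p 0 + 0\<^sub>m 0 q * 0\<^sub>m q 0)"
    unfolding hcat_def append_rows_def using assms
    by (subst mult_four_block_mat[of _ n p _ q _ 0 _ _ m _ 0]) auto
  also have "\<dots> = X * C + Y * D" using assms by (intro eq_matI) auto
  finally show ?thesis .
qed

lemma col_hcat:
  assumes "X \<in> carrier_mat n p" "Y \<in> carrier_mat n q"
  shows "i < p \<Longrightarrow> col (hcat X Y) i = col X i" "i < q \<Longrightarrow> col (hcat X Y) (p + i) = col Y i"
  using assms by (auto simp: hcat_def intro!: eq_vecI)

lemma exp_m_four_block_diag:
  assumes X: "X \<in> carrier_mat p p" and Y: "Y \<in> carrier_mat q q"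
  shows "exp_m (four_block_mat X (0\<^sub>m p q) (0\<^sub>m q p) Y) =
    four_block_mat (exp_m X) (0\<^sub>m p q) (0\<^sub>m q p) (exp_m Y)"
proof (rule eq_matI)
  fix i j assume "i < dim_row (four_block_mat (exp_m X) (0\<^sub>m p q) (0\<^sub>m q p) (exp_m Y))"
    "j < dim_col (four_block_mat (exp_m X) (0\<^sub>m p q) (0\<^sub>m q p) (exp_m Y))"
  then have ij: "i < p + q" "j < p + q" using X Y by (auto simp: exp_m_def)
  have "X ^\<^sub>m k \<in> carrier_mat p p" "Y ^\<^sub>m k \<in> carrier_mat q q" for k using X Y by auto
  note dims = carrier_matD[OF this(1)] carrier_matD[OF this(2)] carrier_matD[OF X] carrier_matD[OF Y]
  show "exp_m (four_block_mat X (0\<^sub>m p q) (0\<^sub>m q p) Y) $$ (i, j) =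
      four_block_mat (exp_m X) (0\<^sub>m p q) (0\<^sub>m q p) (exp_m Y) $$ (i, j)"
    using ij by (auto simp: exp_m_def pow_four_block_mat[OF X Y] dims simp del: pow_mat_dim)
qed (use X Y in \<open>auto simp: exp_m_def\<close>)

section \<open>The retractions on the parallel and the perpendicular tangent vectors\<close>

locale stiefel_frame =
  fixes n p :: nat and U Up :: "real mat"
  assumes pn: "p \<le> n" and U: "U \<in> carrier_mat n p" and Up: "Up \<in> carrier_mat n (n - p)"
    and frame: "hcat U Up \<in> O_group n"
begin

abbreviation "q \<equiv> n - p"

lemma UT: "U\<^sup>T \<in> carrier_mat p n" and UpT: "Up\<^sup>T \<in> carrier_mat q n"
  using U Up by auto

lemma frame_cols:
  assumes "i < n" "j < n"
  shows "col (hcat U Up) i \<bullet> col (hcat U Up) j = (if i = j then 1 else 0)"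
proof -
  have H: "hcat U Up \<in> carrier_mat n n" "(hcat U Up)\<^sup>T * hcat U Up = 1\<^sub>m n"
    using frame by (auto simp: O_group_def)
  have "((hcat U Up)\<^sup>T * hcat U Up) $$ (i, j) = col (hcat U Up) i \<bullet> col (hcat U Up) j"
    using H(1) assms by simp
  then show ?thesis using H(2) assms by simp
qed

lemma UTU: "U\<^sup>T * U = 1\<^sub>m p"
  using U pn frame_cols by (intro eq_matI) (auto simp flip: col_hcat(1)[OF U Up])

lemma UpTUp: "Up\<^sup>T * Up = 1\<^sub>m q"
  using Up pn frame_cols by (intro eq_matI) (auto simp flip: col_hcat(2)[OF U Up])

lemma UTUp: "U\<^sup>T * Up = 0\<^sub>m p q"
  using U Up pn frame_cols by (intro eq_matI) (auto simp flip: col_hcat[OF U Up])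

lemma UpTU: "Up\<^sup>T * U = 0\<^sub>m q p"
  using U Up pn frame_cols by (intro eq_matI) (auto simp flip: col_hcat[OF U Up])

lemma UT_cancel: "X \<in> carrier_mat p m \<Longrightarrow> U\<^sup>T * (U * X) = X"
  using assoc_mult_mat[OF UT U, of X m] UTU by simp

lemma UpT_cancel: "X \<in> carrier_mat q m \<Longrightarrow> Up\<^sup>T * (Up * X) = X"
  using assoc_mult_mat[OF UpT Up, of X m] UpTUp by simp

lemma UT_Up_zero: "X \<in> carrier_mat q m \<Longrightarrow> U\<^sup>T * (Up * X) = 0\<^sub>m p m"
  using assoc_mult_mat[OF UT Up, of X m] UTUp by simp

lemma UpT_U_zero: "X \<in> carrier_mat p m \<Longrightarrow> Up\<^sup>T * (U * X) = 0\<^sub>m q m"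
  using assoc_mult_mat[OF UpT U, of X m] UpTU by simp

lemmas cancel = UT_cancel UpT_cancel UT_Up_zero UpT_U_zero

lemma blocks:
  assumes "A \<in> carrier_mat p p" "B \<in> carrier_mat q p"
  shows "U\<^sup>T * (U * A + Up * B) = A" "Up\<^sup>T * (U * A + Up * B) = B"
proof -
  have c: "U * A \<in> carrier_mat n p" "Up * B \<in> carrier_mat n p" using assms U Up by auto
  show "U\<^sup>T * (U * A + Up * B) = A" "Up\<^sup>T * (U * A + Up * B) = B"
    using mult_add_distrib_mat[OF UT c] mult_add_distrib_mat[OF UpT c] assms
    by (simp_all add: cancel)
qed

lemma dims: "dim_col U = p" "dim_col Up = q" "dim_row U = n" "dim_row Up = n"
  using U Up by auto

lemma R_PL_par:
  assumes A: "A \<in> carrier_mat p p"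
  shows "R_PL U Up (U * A) = U * exp_m A"
proof -
  have E: "exp_m A \<in> carrier_mat p p" by (rule exp_m_carrier[OF A])
  have 0: "Up * 0\<^sub>m q p = 0\<^sub>m n p" "1\<^sub>m p + (0\<^sub>m q p)\<^sup>T * 0\<^sub>m q p = (1\<^sub>m p :: real mat)"
    using Up by auto
  have "R_PL U Up (U * A) = (U * exp_m A + 0\<^sub>m n p) * 1\<^sub>m p"
    using A by (simp add: R_PL_def Let_def cancel dims 0 inv_sqrt_one hcat_mult_append_rows[OF U Up E])
  then show ?thesis using right_mult_one_mat[OF mult_carrier_mat[OF U E]] mult_carrier_mat[OF U E] by simp
qed

text \<open>For \<open>B = 0\<close> the block matrix is diagonal, hence so is its exponential, and the factors \<open>exp(2\<beta>A)\<close> and \<open>exp((1 - 2\<beta>)A)\<close>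
  multiply to \<open>exp(A)\<close>, which is how \<open>\<beta>\<close> drops out.\<close>
lemma Exp_par:
  assumes "A \<in> skew p"
  shows "Exp_St \<beta> U Up (U * A) = U * exp_m A"
proof -
  note A = skewD[OF assms]
  let ?E = "exp_m ((2 * \<beta>) \<cdot>\<^sub>m A)" and ?F = "exp_m ((1 - 2 * \<beta>) \<cdot>\<^sub>m A)"
  have E: "?E \<in> carrier_mat p p" and F: "?F \<in> carrier_mat p p" using A(1) by (auto simp: exp_m_carrier)
  have z: "- 0\<^sub>m p q = (0\<^sub>m p q :: real mat)" by (intro eq_matI) auto
  let ?X = "four_block_mat ?E (0\<^sub>m p q) (0\<^sub>m q p) (1\<^sub>m q)"
  have "exp_m (four_block_mat ((2 * \<beta>) \<cdot>\<^sub>m A) (0\<^sub>m p q) (0\<^sub>m q p) (0\<^sub>m q q)) = ?X"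
    using A(1) by (subst exp_m_four_block_diag[of _ p _ q]) (auto simp: exp_m_zero)
  then have "Exp_St \<beta> U Up (U * A) = hcat U Up * ?X * (1\<^sub>m p @\<^sub>r 0\<^sub>m q p) * ?F"
    using A(1) by (simp add: Exp_St_def Let_def cancel dims z)
  also have "hcat U Up * ?X * (1\<^sub>m p @\<^sub>r 0\<^sub>m q p) = hcat U Up * (?X * (1\<^sub>m p @\<^sub>r 0\<^sub>m q p))"
    using E by (intro assoc_mult_mat[OF hcat_carrier[OF U Up], of _ "p + q" _ p]) auto
  also have "?X * (1\<^sub>m p @\<^sub>r 0\<^sub>m q p) = ?E @\<^sub>r 0\<^sub>m q p"
    unfolding append_rows_def using E
    by (subst mult_four_block_mat[of _ p p _ q _ q _ _ p _ 0]) (auto intro!: cong_four_block_mat)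
  also have "hcat U Up * (?E @\<^sub>r 0\<^sub>m q p) = U * ?E + Up * 0\<^sub>m q p"
    by (rule hcat_mult_append_rows[OF U Up E]) simp
  also have "\<dots> = U * ?E" using U Up E by simp
  also have "U * ?E * ?F = U * (?E * ?F)" using U E F by (rule assoc_mult_mat)
  also have "?E * ?F = exp_m A"
  proof -
    have "(2 * \<beta> + (1 - 2 * \<beta>)) \<cdot>\<^sub>m A = A" by (intro eq_matI) auto
    then show ?thesis using exp_m_add_multiples[OF A, of "2 * \<beta>" "1 - 2 * \<beta>"] by simp
  qed
  finally show ?thesis .
qed

lemma gram_U:
  assumes E: "E \<in> carrier_mat p p" and V: "V \<in> carrier_mat n p" "U\<^sup>T * V = E"
  shows "V\<^sup>T * U * U\<^sup>T * V = E\<^sup>T * E"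
proof -
  have VT: "V\<^sup>T \<in> carrier_mat p n" using V by simp
  have "(U\<^sup>T * V)\<^sup>T = V\<^sup>T * U" using transpose_mult[OF UT V(1)] by simp
  then have "V\<^sup>T * U = E\<^sup>T" using V(2) by simp
  moreover have "E\<^sup>T * U\<^sup>T * V = E\<^sup>T * (U\<^sup>T * V)"
    using E UT V(1) by (intro assoc_mult_mat[of _ p p _ n _ p]) auto
  ultimately show ?thesis using V(2) by simp
qed

lemma projection_perp:
  assumes A: "A \<in> carrier_mat p p" and B: "B \<in> carrier_mat q p"
  shows "(1\<^sub>m n - U * U\<^sup>T) * (U * A + Up * B) = Up * B"
proof -
  have c: "U * A \<in> carrier_mat n p" "Up * B \<in> carrier_mat n p" "U * U\<^sup>T \<in> carrier_mat n n"
    using A B U Up by auto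
  have "U * U\<^sup>T * (U * A + Up * B) = U * (U\<^sup>T * (U * A + Up * B))"
    using U UT c by (intro assoc_mult_mat[of _ n p _ n _ p]) auto
  also have "\<dots> = U * A" using blocks[OF A B] by simp
  finally have "(1\<^sub>m n - U * U\<^sup>T) * (U * A + Up * B) = U * A + Up * B - U * A"
    using c left_mult_one_mat[OF add_carrier_mat[OF c(2)]]
    by (simp add: minus_mult_distrib_mat[of _ n n _ _ p])
  also have "\<dots> = Up * B" using c(1,2) by (rule add_diff_cancel_mat)
  finally show ?thesis .
qed

text \<open>On the image of a parallel vector the polar factor is trivial and the normal component vanishes, so
  the formula reduces to the matrix logarithm of \<open>exp_m A\<close>.\<close>
lemma R_PL_inv_par:
  assumes "A \<in> skew p" "in_principal_strip A"
  shows "R_PL_inv U (U * exp_m A) = U * A"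
proof -
  note A = skewD(1)[OF assms(1)]
  have E: "exp_m A \<in> carrier_mat p p" by (rule exp_m_carrier[OF A])
  have V: "U * exp_m A \<in> carrier_mat n p" using U E by simp
  have S: "inv_sqrt ((U * exp_m A)\<^sup>T * U * U\<^sup>T * (U * exp_m A)) = 1\<^sub>m p"
    using gram_U[OF E V UT_cancel[OF E]] exp_m_skew_orthogonal[OF assms(1)] inv_sqrt_one by simp
  have P: "(1\<^sub>m n - U * U\<^sup>T) * (U * exp_m A) = 0\<^sub>m n p"
    using projection_perp[OF E, of "0\<^sub>m q p"] V Up by simp
  show ?thesis
    unfolding R_PL_inv_def Let_def S dims P UT_cancel[OF E]
    using E log_m_exp_m[OF assms] U A by simp
qed

lemma R_PL_perp:
  assumes B: "B \<in> carrier_mat q p"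
  shows "R_PL U Up (Up * B) = (U + Up * B) * inv_sqrt (1\<^sub>m p + B\<^sup>T * B)"
proof -
  have "hcat U Up * (1\<^sub>m p @\<^sub>r B) = U + Up * B"
    using hcat_mult_append_rows[OF U Up _ B, of "1\<^sub>m p"] U by simp
  then show ?thesis using B by (simp add: R_PL_def Let_def cancel dims exp_m_zero)
qed

lemma R_PF_perp:
  assumes B: "B \<in> carrier_mat q p"
  shows "R_PF U Up (Up * B) = (U + Up * B) * inv_sqrt (1\<^sub>m p + B\<^sup>T * B)"
proof -
  have "1\<^sub>m p + (0\<^sub>m p p)\<^sup>T * 0\<^sub>m p p = (1\<^sub>m p :: real mat)" by simp
  then show ?thesis using B by (simp add: R_PF_def Let_def cancel dims)
qed

text \<open>At \<open>V = (U + Up B) W\<close> with \<open>W = (1 + B\<^sup>T B)\<^sup>-\<^sup>1\<^sup>/\<^sup>2\<close>, the block \<open>U\<^sup>T V\<close> is \<open>W\<close> itself. The factor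
  \<open>(W\<^sup>T W)\<^sup>-\<^sup>1\<^sup>/\<^sup>2\<close> in the formula is then \<open>W\<inverse>\<close>, the logarithm is taken at the identity, and the second
  summand recovers \<open>Up B\<close>.\<close>
lemma R_PL_inv_perp:
  assumes B: "B \<in> carrier_mat q p"
  shows "R_PL_inv U ((U + Up * B) * inv_sqrt (1\<^sub>m p + B\<^sup>T * B)) = Up * B"
proof -
  obtain X W where X: "X \<in> spd p" and W_def: "W = inv_sqrt (1\<^sub>m p + B\<^sup>T * B)"
    and W: "W \<in> spd p" "W * X = 1\<^sub>m p" "X * W = 1\<^sub>m p"
    using inv_sqrt_props[OF spd_add_gram[OF spd_one B]] by metis
  note Xc = spdD(1)[OF X] and Wc = spdD(1)[OF W(1)]
  define Y where "Y = U + Up * B"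
  have Y: "Y = U * 1\<^sub>m p + Up * B" using U by (simp add: Y_def)
  have UpB: "Up * B \<in> carrier_mat n p" using Up B by simp
  have Yc: "Y \<in> carrier_mat n p" using U UpB by (simp add: Y_def)
  have UY: "U\<^sup>T * Y = 1\<^sub>m p" unfolding Y using B by (intro blocks) auto
  have UV: "U\<^sup>T * (Y * W) = W"
    using assoc_mult_mat[OF UT Yc Wc] UY Wc by simp
  have S: "inv_sqrt ((Y * W)\<^sup>T * U * U\<^sup>T * (Y * W)) = X"
    using gram_U[OF Wc _ UV] Yc Wc spdD(2)[OF W(1)] inv_sqrt_square[OF W(1) Xc W(3)] by simp
  let ?P = "1\<^sub>m n - U * U\<^sup>T"
  have Pc: "?P \<in> carrier_mat n n" using U by (intro minus_carrier_mat) auto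
  have YWX: "Y * W * X = Y" using assoc_mult_mat[OF Yc Wc Xc] W(2) Yc by simp
  have "?P * (Y * W) * X = ?P * (Y * W * X)"
    using Pc Yc Wc Xc by (intro assoc_mult_mat[of _ n n _ p _ p]) auto
  also have "\<dots> = Up * B" unfolding YWX unfolding Y using B by (intro projection_perp) auto
  finally have P: "?P * (Y * W) * X = Up * B" .
  have "R_PL_inv U (Y * W) = U * log_m (1\<^sub>m p) + Up * B"
    unfolding R_PL_inv_def Let_def S dims P UV W(2) ..
  also have "\<dots> = Up * B" using U UpB by (simp add: log_m_one)
  finally show ?thesis unfolding Y_def W_def .
qed

text \<open>From \<open>V = R_PF U Up \<xi>\<close> put \<open>M = U\<^sup>T V\<close> and let \<open>X = (1 + A\<^sup>T A + B\<^sup>T B)\<^sup>1\<^sup>/\<^sup>2\<close>. Then \<open>M X = 1 + A\<close>, and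
  skew-symmetry of \<open>A\<close> gives \<open>M X + X M\<^sup>T = 2\<close>. This Lyapunov equation determines \<open>X\<close> from \<open>V\<close>, and then
  \<open>\<xi> = V X - U\<close>.\<close>
lemma R_PF_inj: "inj_on (R_PF U Up) (T_St U Up)"
proof (rule inj_onI)
  fix \<xi> \<xi>' assume "\<xi> \<in> T_St U Up" "\<xi>' \<in> T_St U Up" and eq: "R_PF U Up \<xi> = R_PF U Up \<xi>'"
  have key: "\<exists>X \<in> spd p. R_PF U Up \<xi> * X = U + \<xi> \<and> R_PF U Up \<xi> \<in> carrier_mat n p \<and> \<xi> \<in> carrier_mat n p \<and>
      U\<^sup>T * R_PF U Up \<xi> * X + X * (U\<^sup>T * R_PF U Up \<xi>)\<^sup>T = 2 \<cdot>\<^sub>m 1\<^sub>m p"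
    if \<xi>: "\<xi> \<in> T_St U Up" for \<xi>
  proof -
    obtain A B where \<xi>_def: "\<xi> = U * A + Up * B" and As: "A \<in> skew p" and B: "B \<in> carrier_mat q p"
      using \<xi> by (auto simp: T_St_def dims)
    note A = skewD[OF As]
    have \<xi>c: "\<xi> \<in> carrier_mat n p" using A(1) B U Up by (simp add: \<xi>_def)
    have bl: "U\<^sup>T * \<xi> = A" "Up\<^sup>T * \<xi> = B" using blocks[OF A(1) B] by (auto simp: \<xi>_def)
    obtain X W where X: "X \<in> spd p" and W_def: "W = inv_sqrt (1\<^sub>m p + A\<^sup>T * A + B\<^sup>T * B)"
      and W: "W \<in> spd p" "W * X = 1\<^sub>m p" "X * W = 1\<^sub>m p"
      using inv_sqrt_props[OF spd_add_gram[OF spd_add_gram[OF spd_one A(1)] B]] by metis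
    note Xc = spdD(1,2)[OF X] and Wc = spdD(1,2)[OF W(1)]
    have R: "R_PF U Up \<xi> = (U + \<xi>) * W" by (simp add: R_PF_def Let_def bl dims W_def)
    have c: "U + \<xi> \<in> carrier_mat n p" using U \<xi>c by simp
    have RX: "R_PF U Up \<xi> * X = U + \<xi>"
      unfolding R using assoc_mult_mat[OF c Wc(1) Xc(1)] W(2) right_mult_one_mat[OF c] by simp
    have Rc: "R_PF U Up \<xi> \<in> carrier_mat n p" unfolding R using c Wc by simp
    define M where "M = U\<^sup>T * R_PF U Up \<xi>"
    have Mc: "M \<in> carrier_mat p p" using UT Rc by (simp add: M_def)
    have "M * X = U\<^sup>T * (U + \<xi>)" unfolding M_def using assoc_mult_mat[OF UT Rc Xc(1)] RX by simp
    also have "\<dots> = 1\<^sub>m p + A" using mult_add_distrib_mat[OF UT U \<xi>c] UTU bl by simp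
    finally have MX: "M * X = 1\<^sub>m p + A" .
    have "X * M\<^sup>T = (M * X)\<^sup>T" using transpose_mult[OF Mc Xc(1)] Xc(2) by simp
    also have "\<dots> = 1\<^sub>m p + A\<^sup>T" unfolding MX using A(1) by (subst transpose_add[of _ p p]) auto
    finally have "M * X + X * M\<^sup>T = 2 \<cdot>\<^sub>m 1\<^sub>m p"
      unfolding MX A(2) using A(1) by (intro eq_matI) auto
    then show ?thesis using X RX Rc \<xi>c by (auto simp: M_def)
  qed
  define V where "V = R_PF U Up \<xi>"
  define M where "M = U\<^sup>T * V"
  obtain X where X: "X \<in> spd p" "V * X = U + \<xi>" "V \<in> carrier_mat n p" "\<xi> \<in> carrier_mat n p"
    "M * X + X * M\<^sup>T = 2 \<cdot>\<^sub>m 1\<^sub>m p"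
    using key[OF \<open>\<xi> \<in> T_St U Up\<close>] unfolding V_def M_def by blast
  obtain X' where X': "X' \<in> spd p" "V * X' = U + \<xi>'" "\<xi>' \<in> carrier_mat n p"
    "M * X' + X' * M\<^sup>T = 2 \<cdot>\<^sub>m 1\<^sub>m p"
    using key[OF \<open>\<xi>' \<in> T_St U Up\<close>] unfolding V_def M_def eq by blast
  note Xc = spdD(1,2)[OF X(1)] and X'c = spdD(1,2)[OF X'(1)]
  have Mc: "M \<in> carrier_mat p p" and MT: "M\<^sup>T \<in> carrier_mat p p" using UT X(3) by (auto simp: M_def)
  have two: "(2 :: real) \<cdot>\<^sub>m 1\<^sub>m p = 1\<^sub>m p + 1\<^sub>m p" by (intro eq_matI) auto
  have "X - X' = 0\<^sub>m p p"
  proof (rule lyapunov_unique[OF Mc _ _ X(1)])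
    show "X - X' \<in> carrier_mat p p" "(X - X')\<^sup>T = X - X'"
      using Xc X'c by (auto simp: transpose_minus[of _ p p] intro: minus_carrier_mat)
    show "M * X + X * M\<^sup>T \<in> spd p" unfolding X(5) two by (intro spd_add spd_one)
    have c: "M * X \<in> carrier_mat p p" "M * X' \<in> carrier_mat p p" "X * M\<^sup>T \<in> carrier_mat p p" "X' * M\<^sup>T \<in> carrier_mat p p"
      using Mc MT Xc X'c by auto
    have "M * (X - X') + (X - X') * M\<^sup>T = (M * X - M * X') + (X * M\<^sup>T - X' * M\<^sup>T)"
      using Mc MT Xc(1) X'c(1)
      by (simp add: minus_mult_distrib_mat[of _ p p _ _ p] mult_minus_distrib_mat[of _ p p _ p])
    also have "\<dots> = (M * X + X * M\<^sup>T) - (M * X' + X' * M\<^sup>T)" using c by (rule diff_add_diff_mat)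
    also have "\<dots> = 0\<^sub>m p p" unfolding X(5) X'(4) by (intro eq_matI) auto
    finally show "M * (X - X') + (X - X') * M\<^sup>T = 0\<^sub>m p p" .
  qed
  then have "X = X'" using Xc X'c by (auto simp: mat_eq_iff)
  then have eqU: "U + \<xi> = U + \<xi>'" using X(2) X'(2) by simp
  show "\<xi> = \<xi>'"
  proof (rule eq_matI)
    fix i j assume ij: "i < dim_row \<xi>'" "j < dim_col \<xi>'"
    have "(U + \<xi>) $$ (i, j) = (U + \<xi>') $$ (i, j)" unfolding eqU ..
    then show "\<xi> $$ (i, j) = \<xi>' $$ (i, j)" using ij U X(4) X'(3) by simp
  qed (use X X' in auto)
qed

lemma par_in_T_St:
  assumes "A \<in> skew p"
  shows "U * A \<in> T_St U Up"
proof -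
  have "U * A \<in> carrier_mat n p" using U skewD(1)[OF assms] by simp
  then have "U * A = U * A + Up * 0\<^sub>m q p" using Up by simp
  then show ?thesis unfolding T_St_def dims using assms zero_carrier_mat by blast
qed

lemma perp_in_T_St:
  assumes "B \<in> carrier_mat q p"
  shows "Up * B \<in> T_St U Up"
proof -
  have "Up * B \<in> carrier_mat n p" using Up assms by simp
  then have "Up * B = U * 0\<^sub>m p p + Up * B" using U by simp
  then show ?thesis unfolding T_St_def dims using assms zero_skew by blast
qed

lemma beta_metric_par:
  assumes "A \<in> skew p"
  shows "beta_metric \<beta> U Up (U * A) (U * A) = \<beta> * mtrace ((-1) \<cdot>\<^sub>m (A * A))"
proof -
  note A = skewD[OF assms]
  have "A\<^sup>T * A = (-1) \<cdot>\<^sub>m (A * A)"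
    unfolding A(2) using A(1) A(1) by (rule mult_smult_assoc_mat)
  moreover have "mtrace ((0\<^sub>m q p)\<^sup>T * 0\<^sub>m q p) = 0" by (simp add: mtrace_def)
  ultimately show ?thesis using A(1) by (simp add: beta_metric_def cancel)
qed

lemma mtrace_skew_square_nonneg:
  assumes "A \<in> skew p"
  shows "mtrace ((-1) \<cdot>\<^sub>m (A * A)) \<ge> 0"
proof -
  note A = skewD[OF assms]
  have "(-1) \<cdot>\<^sub>m (A * A) = A\<^sup>T * A"
    unfolding A(2) using mult_smult_assoc_mat[OF A(1) A(1), of "-1"] by simp
  then show ?thesis using A(1) by (auto simp: mtrace_def scalar_prod_def intro!: sum_nonneg)
qed

lemma smult_skew: "A \<in> skew p \<Longrightarrow> t \<cdot>\<^sub>m A \<in> skew p"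
proof (rule skewI)
  assume "A \<in> skew p"
  note A = skewD[OF this]
  have "(t \<cdot>\<^sub>m A)\<^sup>T = t \<cdot>\<^sub>m A\<^sup>T" by (intro eq_matI) auto
  also have "\<dots> = (-1) \<cdot>\<^sub>m (t \<cdot>\<^sub>m A)" unfolding A(2) by (intro eq_matI) auto
  finally show "(t \<cdot>\<^sub>m A)\<^sup>T = (-1) \<cdot>\<^sub>m (t \<cdot>\<^sub>m A)" .
qed (auto dest: skewD)

text \<open>Otherwise the ball contains \<open>U (t A)\<close> and \<open>U A'\<close>, with \<open>t\<close> and \<open>A'\<close> as in
  \<open>exp_m_not_injective_outside_strip\<close>, since \<open>t \<le> 1\<close> and \<open>\<parallel>A'\<parallel> = \<parallel>t A\<parallel>\<close>; but they have the same image
  under the Riemannian exponential.\<close>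
lemma normal_ball_in_strip:
  assumes "\<beta> > 0" and inj: "inj_on (Exp_St \<beta> U Up) (T_ball \<beta> U Up r)"
    and As: "A \<in> skew p" and ball: "U * A \<in> T_ball \<beta> U Up r"
  shows "in_principal_strip A"
proof (rule ccontr)
  assume "\<not> in_principal_strip A"
  then obtain t A' where t: "0 \<le> t" "t \<le> 1" and A': "A' \<in> skew p" "A' \<noteq> t \<cdot>\<^sub>m A"
    "A' * A' = (t \<cdot>\<^sub>m A) * (t \<cdot>\<^sub>m A)" "exp_m A' = exp_m (t \<cdot>\<^sub>m A)"
    by (rule exp_m_not_injective_outside_strip[OF As])
  note A = skewD[OF As] and A'c = skewD(1)[OF A'(1)]
  let ?m = "mtrace ((-1) \<cdot>\<^sub>m (A * A))"
  have "(t \<cdot>\<^sub>m A) * (t \<cdot>\<^sub>m A) = (t * t) \<cdot>\<^sub>m (A * A)"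
    using A(1) by (simp add: mult_smult_assoc_mat[of _ p p _ p] mult_smult_distrib[of _ p p _ p])
      (auto intro!: eq_matI)
  then have "mtrace ((-1) \<cdot>\<^sub>m ((t \<cdot>\<^sub>m A) * (t \<cdot>\<^sub>m A))) = t * t * ?m"
    using A(1) by (simp add: mtrace_def sum_distrib_left sum_negf)
  then have norm: "beta_metric \<beta> U Up (U * C) (U * C) = \<beta> * (t * t * ?m)"
    if "C \<in> {t \<cdot>\<^sub>m A, A'}" for C
    using that beta_metric_par[OF smult_skew[OF As]] beta_metric_par[OF A'(1)] A'(3) by auto
  have "t * t * ?m \<le> ?m"
    using mtrace_skew_square_nonneg[OF As] t by (intro mult_left_le_one_le) (auto simp: mult_le_one)
  then have "\<beta> * (t * t * ?m) \<le> beta_metric \<beta> U Up (U * A) (U * A)"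
    unfolding beta_metric_par[OF As] using \<open>\<beta> > 0\<close> by simp
  then have "sqrt (\<beta> * (t * t * ?m)) \<le> sqrt (beta_metric \<beta> U Up (U * A) (U * A))"
    by (rule real_sqrt_le_mono)
  also have "\<dots> < r" using ball by (simp add: T_ball_def)
  finally have "sqrt (\<beta> * (t * t * ?m)) < r" .
  then have "U * C \<in> T_ball \<beta> U Up r" if "C \<in> {t \<cdot>\<^sub>m A, A'}" for C
    using norm[OF that] that par_in_T_St[OF smult_skew[OF As]] par_in_T_St[OF A'(1)]
    unfolding T_ball_def by auto
  moreover have "Exp_St \<beta> U Up (U * A') = Exp_St \<beta> U Up (U * (t \<cdot>\<^sub>m A))"
    using Exp_par[OF A'(1)] Exp_par[OF smult_skew[OF As]] A'(4) by simp
  ultimately have eq: "U * A' = U * (t \<cdot>\<^sub>m A)" using inj by (auto dest: inj_onD)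
  have "A' = U\<^sup>T * (U * A')" using UT_cancel[OF A'c] by (rule sym)
  also have "\<dots> = t \<cdot>\<^sub>m A" unfolding eq using A(1) by (intro UT_cancel[of _ p]) simp
  finally show False using A'(2) by contradiction
qed

lemma Log_domain_strip:
  assumes "\<beta> > 0" and D: "Log_domain \<beta> U Up D" and As: "A \<in> skew p" and "U * A \<in> D"
  shows "in_principal_strip A"
proof -
  consider r where "D = T_ball \<beta> U Up r" | "T_par U \<inter> D \<subseteq> R_PL_dom U Up"
    using D unfolding Log_domain_def by blast
  then show ?thesis
  proof cases
    case 1
    then have "inj_on (Exp_St \<beta> U Up) (T_ball \<beta> U Up r)" using D by (simp add: Log_domain_def)
    then show ?thesis using normal_ball_in_strip[OF assms(1) _ As] assms(4) 1 by blast
  next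
    case 2
    have "U * A \<in> T_par U" using As by (auto simp: T_par_def dims)
    then have "U * A \<in> R_PL_dom U Up" using 2 assms(4) by blast
    then show ?thesis using UT_cancel[OF skewD(1)[OF As]] by (simp add: R_PL_dom_def)
  qed
qed

lemma T_parE:
  assumes "\<xi> \<in> T_par U"
  obtains A where "A \<in> skew p" "\<xi> = U * A"
  using assms by (auto simp: T_par_def dims)

lemma T_perpE:
  assumes "\<xi> \<in> T_perp U Up"
  obtains B where "B \<in> carrier_mat q p" "\<xi> = Up * B"
  using assms by (auto simp: T_perp_def dims)

lemma R_PL_eq_Exp_par: "\<xi> \<in> T_par U \<Longrightarrow> R_PL U Up \<xi> = Exp_St \<beta> U Up \<xi>"
  by (elim T_parE) (simp add: R_PL_par Exp_par skewD(1))

lemma R_PL_inv_eq_Log_par: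
  assumes "\<beta> > 0" "Log_domain \<beta> U Up D" "\<xi> \<in> T_par U \<inter> D"
  shows "R_PL_inv U (R_PL U Up \<xi>) = \<xi>" "Log_St \<beta> U Up D (Exp_St \<beta> U Up \<xi>) = \<xi>"
proof -
  obtain A where A: "A \<in> skew p" "\<xi> = U * A" using assms(3) T_parE by blast
  then have "in_principal_strip A" using Log_domain_strip assms by blast
  then show "R_PL_inv U (R_PL U Up \<xi>) = \<xi>"
    using A by (simp add: R_PL_par skewD(1) R_PL_inv_par)
  show "Log_St \<beta> U Up D (Exp_St \<beta> U Up \<xi>) = \<xi>"
    using assms(2,3) unfolding Log_St_def Log_domain_def by (intro inv_into_f_f) auto
qed

lemma R_PL_eq_R_PF_perp: "\<xi> \<in> T_perp U Up \<Longrightarrow> R_PL U Up \<xi> = R_PF U Up \<xi>"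
  by (elim T_perpE) (simp add: R_PL_perp R_PF_perp)

lemma inverses_perp:
  assumes "\<xi> \<in> T_perp U Up"
  shows "R_PL_inv U (R_PL U Up \<xi>) = \<xi>" "R_PF_inv U Up (R_PF U Up \<xi>) = \<xi>"
proof -
  obtain B where B: "B \<in> carrier_mat q p" "\<xi> = Up * B" using assms T_perpE by blast
  show "R_PL_inv U (R_PL U Up \<xi>) = \<xi>" using B by (simp add: R_PL_perp R_PL_inv_perp)
  show "R_PF_inv U Up (R_PF U Up \<xi>) = \<xi>"
    unfolding R_PF_inv_def using B perp_in_T_St R_PF_inj by (intro inv_into_f_f) auto
qed

end

theorem lemma3p4:
  fixes n p :: nat and U Up :: "real mat" and \<beta> :: real
  assumes "p \<le> n"
    and "U \<in> St n p"
    and "Up \<in> carrier_mat n (n - p)"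
    and "hcat U Up \<in> O_group n"
    and "\<beta> > 0"
  shows "restrict (R_PL U Up) (T_par U) = restrict (Exp_St \<beta> U Up) (T_par U)
       \<and> (\<forall>D. Log_domain \<beta> U Up D \<longrightarrow>
             restrict (R_PL_inv U) (R_PL U Up ` (T_par U \<inter> D))
             = restrict (Log_St \<beta> U Up D) (Exp_St \<beta> U Up ` (T_par U \<inter> D)))
       \<and> restrict (R_PL U Up) (T_perp U Up) = restrict (R_PF U Up) (T_perp U Up)
       \<and> restrict (R_PL_inv U) (R_PL U Up ` T_perp U Up)
           = restrict (R_PF_inv U Up) (R_PF U Up ` T_perp U Up)"
proof -
  interpret stiefel_frame n p U Up
    using assms by unfold_locales (auto simp: St_def)
  have par: "restrict (R_PL_inv U) (R_PL U Up ` (T_par U \<inter> D))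
      = restrict (Log_St \<beta> U Up D) (Exp_St \<beta> U Up ` (T_par U \<inter> D))" if D: "Log_domain \<beta> U Up D" for D
  proof -
    have "R_PL U Up ` (T_par U \<inter> D) = Exp_St \<beta> U Up ` (T_par U \<inter> D)"
      using R_PL_eq_Exp_par[of _ \<beta>] by (intro image_cong) auto
    moreover have "R_PL_inv U y = Log_St \<beta> U Up D y" if "y \<in> Exp_St \<beta> U Up ` (T_par U \<inter> D)" for y
      using that R_PL_inv_eq_Log_par[OF \<open>\<beta> > 0\<close> D] R_PL_eq_Exp_par[of _ \<beta>] by auto
    ultimately show ?thesis by (auto intro: restrict_ext)
  qed
  have "R_PL U Up ` T_perp U Up = R_PF U Up ` T_perp U Up"
    using R_PL_eq_R_PF_perp by (intro image_cong) auto
  moreover have "R_PL_inv U y = R_PF_inv U Up y" if "y \<in> R_PF U Up ` T_perp U Up" for y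
    using that inverses_perp R_PL_eq_R_PF_perp by auto
  ultimately have "restrict (R_PL_inv U) (R_PL U Up ` T_perp U Up)
      = restrict (R_PF_inv U Up) (R_PF U Up ` T_perp U Up)"
    by (auto intro: restrict_ext)
  then show ?thesis
    using par R_PL_eq_Exp_par R_PL_eq_R_PF_perp by (auto intro!: restrict_ext)
qed

end
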